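(* There exists an algorithm that, given an integer $k\ge 1$ and an $n$-vertex graph $G$ together with a $w$-expression (of size polynomial in $n$ and $w$) whose underlying unlabelled graph is $G$, computes the number of equitable $k$-colorings of $G$ in time $2^{O(k\cdot w)}\cdot n^{O(k)}$. In particular, for every fixed $k$, counting equitable $k$-colorings is polynomial-time solvable on every graph class of bounded clique-width, when a clique-width expression is given with the input.
   Context: Graphs are finite, without loops or parallel edges. A $k$-coloring of $G$ is a map $\varphi:V(G)\to[k]=\{1,\dots,k\}$ with $\varphi(u)\ne\varphi(v)$ for every edge $uv$ (i.e. it is proper); it is equitable if $\bigl||\varphi^{-1}(i)|-|\varphi^{-1}(j)|\bigr|\le 1$ for all $i,j\in[k]$. Colorings are counted as maps. For $w\ge 1$, a $w$-labelled graph is a graph $G$ together with a labelling function $\mathrm{lab}:V(G)\to[w]$. A $w$-expression is a valid term built from the following operations on $w$-labelled graphs: (1) for $i\in[w]$, introduce a single-vertex graph whose vertex has label $i$; (2) the disjoint union of two $w$-labelled graphs; (3) for distinct $i,j\in[w]$, relabel: change the label of every vertex of label $i$ to $j$; (4) for distinct $i,j\in[w]$, join: add all edges with one endpoint of label $i$ and the other of label $j$. The clique-width $\mathrm{cw}(G)$ is the least $w$ such that some $w$-expression has underlying unlabelled graph $G$. A graph class has bounded clique-width if there is a constant $c$ with $\mathrm{cw}(G)\le c$ for all $G$ in the class. *)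

theory Defs
  imports
    Main
    "HOL-Library.FuncSet"
    "HOL-Computational_Algebra.Polynomial"
begin

section \<open>Graphs and equitable colorings\<close>

definition simple_graph :: "'a set \<Rightarrow> 'a set set \<Rightarrow> bool" where
  "simple_graph V E \<longleftrightarrow> finite V \<and> (\<forall>e\<in>E. \<exists>u v. e = {u, v} \<and> u \<in> V \<and> v \<in> V \<and> u \<noteq> v)"

text \<open>Colorings are maps on \<open>V\<close>: they are taken extensional, so that each map is counted once.\<close>

definition colorings :: "nat \<Rightarrow> 'a set \<Rightarrow> 'a set set \<Rightarrow> ('a \<Rightarrow> nat) set" where
  "colorings k V E =
     {\<phi> \<in> V \<rightarrow>\<^sub>E {1..k}. \<forall>u v. {u, v} \<in> E \<longrightarrow> \<phi> u \<noteq> \<phi> v}"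

definition equitable :: "nat \<Rightarrow> 'a set \<Rightarrow> ('a \<Rightarrow> nat) \<Rightarrow> bool" where
  "equitable k V \<phi> \<longleftrightarrow>
     (\<forall>i\<in>{1..k}. \<forall>j\<in>{1..k}.
        \<bar>int (card {v \<in> V. \<phi> v = i}) - int (card {v \<in> V. \<phi> v = j})\<bar> \<le> 1)"

definition num_equitable_colorings :: "nat \<Rightarrow> 'a set \<Rightarrow> 'a set set \<Rightarrow> nat" where
  "num_equitable_colorings k V E = card {\<phi> \<in> colorings k V E. equitable k V \<phi>}"


section \<open>Clique-width\<close>

datatype cw_expr =
    Introduce nat
  | Disjoint_Union cw_expr cw_expr
  | Relabel nat nat cw_expr
  | Join nat nat cw_expr

text \<open>
  \<open>builds w t V E lab\<close>: the term \<open>t\<close> is a valid \<open>w\<close>-expression, and it produces the labelled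
  graph \<open>(V, E, lab)\<close>. The names of the introduced vertices are left open (subject to
  disjointness), so the graphs that \<open>t\<close> produces form an isomorphism class.
  The values of \<open>lab\<close> outside \<open>V\<close> are irrelevant.
\<close>

inductive builds ::
  "nat \<Rightarrow> cw_expr \<Rightarrow> 'a set \<Rightarrow> 'a set set \<Rightarrow> ('a \<Rightarrow> nat) \<Rightarrow> bool" for w :: nat where
  introduce:
    "i \<in> {1..w} \<Longrightarrow> builds w (Introduce i) {v} {} (\<lambda>_. i)"
| disjoint_union:
    "builds w s V E lab \<Longrightarrow> builds w t V' E' lab' \<Longrightarrow> V \<inter> V' = {} \<Longrightarrow>
     builds w (Disjoint_Union s t) (V \<union> V') (E \<union> E') (\<lambda>v. if v \<in> V then lab v else lab' v)"
| relabel: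
    "builds w t V E lab \<Longrightarrow> i \<in> {1..w} \<Longrightarrow> j \<in> {1..w} \<Longrightarrow> i \<noteq> j \<Longrightarrow>
     builds w (Relabel i j t) V E (\<lambda>v. if lab v = i then j else lab v)"
| join:
    "builds w t V E lab \<Longrightarrow> i \<in> {1..w} \<Longrightarrow> j \<in> {1..w} \<Longrightarrow> i \<noteq> j \<Longrightarrow>
     builds w (Join i j t) V
       (E \<union> {{u, v} | u v. u \<in> V \<and> v \<in> V \<and> lab u = i \<and> lab v = j}) lab"

definition w_expression_of :: "nat \<Rightarrow> cw_expr \<Rightarrow> 'a set \<Rightarrow> 'a set set \<Rightarrow> bool" where
  "w_expression_of w t V E \<longleftrightarrow> (\<exists>lab. builds w t V E lab)"

fun num_ops :: "cw_expr \<Rightarrow> nat" where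
  "num_ops (Introduce i) = 1"
| "num_ops (Disjoint_Union s t) = num_ops s + num_ops t + 1"
| "num_ops (Relabel i j t) = num_ops t + 1"
| "num_ops (Join i j t) = num_ops t + 1"

text \<open>Every nonempty finite graph has an expression; for the empty graph the value is unspecified.\<close>

definition clique_width :: "'a set \<Rightarrow> 'a set set \<Rightarrow> nat" where
  "clique_width V E = (LEAST w. 1 \<le> w \<and> (\<exists>t. w_expression_of w t V E))"

definition bounded_clique_width :: "('a set \<times> 'a set set) set \<Rightarrow> bool" where
  "bounded_clique_width \<G> \<longleftrightarrow> (\<exists>c. \<forall>(V, E)\<in>\<G>. clique_width V E \<le> c)"


section \<open>Algorithms and running time\<close>

text \<open>
  Algorithms are programs of a first-order, call-by-value, recursive language whose only data are
  binary trees (as in pure LISP, or the languages WHILE and F of Jones, \<^emph>\<open>Computability and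
  Complexity from a Programming Perspective\<close>). Every elementary operation touches
  a bounded number of cells and costs one unit: reading an argument, building a cell, taking a
  component, testing for \<open>Nul\<close>, calling a function. There is no arithmetic and no comparison of
  unbounded data at unit cost. Since trees can be shared in memory, this
  cost is polynomially related to Turing machine time.
\<close>

datatype val = Nul | Cell val val

datatype tm =
    Arg nat
  | MkNul
  | MkCell tm tm
  | Left tm
  | Right tm
  | If_Nul tm tm tm
  | Call nat "tm list"

text \<open>
  A program is a finite list of function bodies; \<open>Call f\<close> refers to entry \<open>f\<close> of
  the list, and entry \<open>0\<close> is the main function. Inside a body, \<open>Arg i\<close> is the \<open>i\<close>-th argument.
\<close>

type_synonym program = "tm list"

fun left_of :: "val \<Rightarrow> val" where
  "left_of Nul = Nul"
| "left_of (Cell a b) = a"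

fun right_of :: "val \<Rightarrow> val" where
  "right_of Nul = Nul"
| "right_of (Cell a b) = b"

text \<open>
  \<open>eval P \<rho> e x t\<close>: with argument list \<open>\<rho>\<close>, the term \<open>e\<close> evaluates to \<open>x\<close> in exactly \<open>t\<close> steps.
\<close>

inductive eval :: "program \<Rightarrow> val list \<Rightarrow> tm \<Rightarrow> val \<Rightarrow> nat \<Rightarrow> bool"
  and evals :: "program \<Rightarrow> val list \<Rightarrow> tm list \<Rightarrow> val list \<Rightarrow> nat \<Rightarrow> bool"
  for P :: program where
  Arg: "i < length \<rho> \<Longrightarrow> eval P \<rho> (Arg i) (\<rho> ! i) 1"
| MkNul: "eval P \<rho> MkNul Nul 1"
| MkCell: "eval P \<rho> a x s \<Longrightarrow> eval P \<rho> b y t \<Longrightarrow> eval P \<rho> (MkCell a b) (Cell x y) (s + t + 1)"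
| Left: "eval P \<rho> a x t \<Longrightarrow> eval P \<rho> (Left a) (left_of x) (t + 1)"
| Right: "eval P \<rho> a x t \<Longrightarrow> eval P \<rho> (Right a) (right_of x) (t + 1)"
| If_Nul: "eval P \<rho> a Nul s \<Longrightarrow> eval P \<rho> b y t \<Longrightarrow> eval P \<rho> (If_Nul a b c) y (s + t + 1)"
| If_Cell: "eval P \<rho> a (Cell x x') s \<Longrightarrow> eval P \<rho> c y t \<Longrightarrow>
    eval P \<rho> (If_Nul a b c) y (s + t + 1)"
| Call: "f < length P \<Longrightarrow> evals P \<rho> as xs s \<Longrightarrow> eval P xs (P ! f) y t \<Longrightarrow>
    eval P \<rho> (Call f as) y (s + t + 1)"
| Empty: "evals P \<rho> [] [] 0"
| More: "eval P \<rho> a x s \<Longrightarrow> evals P \<rho> as xs t \<Longrightarrow> evals P \<rho> (a # as) (x # xs) (s + t)"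

definition outputs_within :: "program \<Rightarrow> val \<Rightarrow> val \<Rightarrow> nat \<Rightarrow> bool" where
  "outputs_within P x y T \<longleftrightarrow> (\<exists>t\<le>T. eval P [x] (Call 0 [Arg 0]) y t)"

text \<open>Results and running times are unique, so the existential quantifier above is harmless.\<close>

inductive_cases eval_ArgE: "eval P \<rho> (Arg i) x t"
inductive_cases eval_MkNulE: "eval P \<rho> MkNul x t"
inductive_cases eval_MkCellE: "eval P \<rho> (MkCell a b) x t"
inductive_cases eval_LeftE: "eval P \<rho> (Left a) x t"
inductive_cases eval_RightE: "eval P \<rho> (Right a) x t"
inductive_cases eval_If_NulE: "eval P \<rho> (If_Nul a b c) x t"
inductive_cases eval_CallE: "eval P \<rho> (Call f as) x t"
inductive_cases evals_NilE: "evals P \<rho> [] xs t"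
inductive_cases evals_ConsE: "evals P \<rho> (a # as) xs t"

lemma eval_deterministic:
  "eval P \<rho> a x s \<Longrightarrow> eval P \<rho> a y t \<Longrightarrow> x = y \<and> s = t"
  "evals P \<rho> as xs s \<Longrightarrow> evals P \<rho> as ys t \<Longrightarrow> xs = ys \<and> s = t"
proof (induction arbitrary: y t and ys t rule: eval_evals.inducts)
  case (Arg i \<rho>)
  from Arg.prems show ?case by (rule eval_ArgE) simp
next
  case (MkNul \<rho>)
  from MkNul.prems show ?case by (rule eval_MkNulE) simp
next
  case (MkCell \<rho> a x s b x' s')
  from MkCell.prems show ?case
    by (rule eval_MkCellE) (simp, metis MkCell.IH)
next
  case (Left \<rho> a x s)
  from Left.prems show ?case
    by (rule eval_LeftE) (simp, metis Left.IH)
next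
  case (Right \<rho> a x s)
  from Right.prems show ?case
    by (rule eval_RightE) (simp, metis Right.IH)
next
  case (If_Nul \<rho> a s b x s' c)
  from If_Nul.prems show ?case
    by (rule eval_If_NulE) (simp, metis If_Nul.IH val.distinct(1))+
next
  case (If_Cell \<rho> a x x' s c z s' b)
  from If_Cell.prems show ?case
    by (rule eval_If_NulE) (simp, metis If_Cell.IH val.distinct(1))+
next
  case (Call f \<rho> as xs s x s')
  from Call.prems show ?case
    by (rule eval_CallE) (simp, metis Call.IH)
next
  case (Empty \<rho>)
  from Empty.prems show ?case by (rule evals_NilE) simp
next
  case (More \<rho> a x s as xs s')
  from More.prems show ?case
    by (rule evals_ConsE) (simp, metis More.IH)
qed


section \<open>Encoding of inputs and outputs\<close>

fun enc_list :: "val list \<Rightarrow> val" where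
  "enc_list [] = Nul"
| "enc_list (x # xs) = Cell x (enc_list xs)"

definition enc_bool :: "bool \<Rightarrow> val" where
  "enc_bool b = (if b then Cell Nul Nul else Nul)"

text \<open>Binary notation, least significant bit first, without leading zeros.\<close>

fun enc_nat :: "nat \<Rightarrow> val" where
  "enc_nat n = (if n = 0 then Nul else Cell (enc_bool (odd n)) (enc_nat (n div 2)))"

declare enc_nat.simps [simp del]

text \<open>The adjacency matrix, with the vertices taken in increasing order.\<close>

definition enc_graph :: "nat set \<Rightarrow> nat set set \<Rightarrow> val" where
  "enc_graph V E =
     (let vs = sorted_list_of_set V
      in enc_list (map (\<lambda>u. enc_list (map (\<lambda>v. enc_bool ({u, v} \<in> E)) vs)) vs))"

fun enc_cw_expr :: "cw_expr \<Rightarrow> val" where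
  "enc_cw_expr (Introduce i) = Cell (enc_nat 0) (enc_nat i)"
| "enc_cw_expr (Disjoint_Union s t) = Cell (enc_nat 1) (Cell (enc_cw_expr s) (enc_cw_expr t))"
| "enc_cw_expr (Relabel i j t) =
     Cell (enc_nat 2) (Cell (enc_nat i) (Cell (enc_nat j) (enc_cw_expr t)))"
| "enc_cw_expr (Join i j t) =
     Cell (enc_nat 3) (Cell (enc_nat i) (Cell (enc_nat j) (enc_cw_expr t)))"

definition enc_instance :: "nat set \<Rightarrow> nat set set \<Rightarrow> cw_expr \<Rightarrow> val" where
  "enc_instance V E t = Cell (enc_graph V E) (enc_cw_expr t)"

end

theory Submission
  imports Defs
begin

text \<open>
  The program runs the dynamic program over the expression. The state of a coloring records, for
  each color, the labels that occur in the color class and its cardinality. This data determines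
  which colorings survive a join, and it is additive under disjoint union, so a table of
  multiplicities of states can be pushed through every operation; the equitable colorings are read
  off the final table. There are at most \<open>D = (2 ^ (w + 2) * (n + 1)) ^ k\<close> states, and \<open>D\<close> also
  bounds \<open>k\<close>, \<open>w\<close>, \<open>n\<close> and the bit lengths of the multiplicities. Hence every operation costs
  \<open>O(D ^ 5)\<close> steps.
\<close>

section \<open>Weakest preconditions that count steps\<close>

section \<open>Symbolic execution\<close>

text \<open>Relabelling can identify keys of a table, so length and multiplicities need separate
  bounds. The length is controlled at disjoint unions, where \<open>insert_entry\<close> produces
  distinct keys from a finite set; relabelling and joining never lengthen a table. The
  multiplicities are controlled by \<open>total\<close>, which stays below
  \<open>k ^ leaves t\<close>. Correctness avoids comparing tables: a table is integrated against an
  arbitrary function \<open>f\<close> of abstract states (\<open>weight\<close>), and each operation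
  on tables becomes an operation on \<open>f\<close>. The exponent 5 comes from disjoint unions:
  \<open>D\<close> times \<open>D\<close> pairs of entries, each costing \<open>D ^ 3\<close> for
  multiplying \<open>D\<close>-bit numbers and for scanning \<open>D\<close> keys of size about
  \<open>D ^ 2\<close>. Labels, \<open>k\<close> and cardinalities are held in unary, as their
  values are at most \<open>D\<close> and list recursion then handles them; only multiplicities,
  possibly as large as \<open>k ^ n\<close>, require binary arithmetic.\<close>

definition wp :: "program \<Rightarrow> val list \<Rightarrow> tm \<Rightarrow> (val \<Rightarrow> nat \<Rightarrow> bool) \<Rightarrow> bool" where
  "wp P \<rho> e Q \<longleftrightarrow> (\<exists>x t. eval P \<rho> e x t \<and> Q x t)"

definition wps :: "program \<Rightarrow> val list \<Rightarrow> tm list \<Rightarrow> (val list \<Rightarrow> nat \<Rightarrow> bool) \<Rightarrow> bool" where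
  "wps P \<rho> as Q \<longleftrightarrow> (\<exists>xs t. evals P \<rho> as xs t \<and> Q xs t)"

text \<open>Opaque to the rewriting of \<open>wp\<close>: symbolic execution halts at a call instead
  of unfolding a recursive function without end.\<close>

definition wp_body :: "program \<Rightarrow> nat \<Rightarrow> val list \<Rightarrow> (val \<Rightarrow> nat \<Rightarrow> bool) \<Rightarrow> bool" where
  "wp_body P f xs Q \<longleftrightarrow> wp P xs (P ! f) Q"

text \<open>Equivalences, so that the simplifier can run a term: one direction builds a derivation,
  the other inverts it.\<close>

lemma wp_simps [simp]:
  "wp P \<rho> (Arg i) Q \<longleftrightarrow> i < length \<rho> \<and> Q (\<rho> ! i) 1"
  "wp P \<rho> MkNul Q \<longleftrightarrow> Q Nul 1"
  "wp P \<rho> (MkCell a b) Q \<longleftrightarrow> wp P \<rho> a (\<lambda>x s. wp P \<rho> b (\<lambda>y t. Q (Cell x y) (s + t + 1)))"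
  "wp P \<rho> (Left a) Q \<longleftrightarrow> wp P \<rho> a (\<lambda>x t. Q (left_of x) (t + 1))"
  "wp P \<rho> (Right a) Q \<longleftrightarrow> wp P \<rho> a (\<lambda>x t. Q (right_of x) (t + 1))"
  "wp P \<rho> (If_Nul a b c) Q \<longleftrightarrow>
     wp P \<rho> a (\<lambda>x s. if x = Nul then wp P \<rho> b (\<lambda>y t. Q y (s + t + 1))
                              else wp P \<rho> c (\<lambda>y t. Q y (s + t + 1)))"
  "wp P \<rho> (Call f as) Q \<longleftrightarrow>
     f < length P \<and> wps P \<rho> as (\<lambda>xs s. wp_body P f xs (\<lambda>y t. Q y (s + t + 1)))"
  "wps P \<rho> [] R \<longleftrightarrow> R [] 0"
  "wps P \<rho> (a # as) R \<longleftrightarrow> wp P \<rho> a (\<lambda>x s. wps P \<rho> as (\<lambda>xs t. R (x # xs) (s + t)))"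
proof -
  \<comment> \<open>\<open>If_Cell\<close> demands a visible \<open>Cell\<close>, whereas the
    equation only tests against \<open>Nul\<close>.\<close>
  have "\<exists>a b. x = Cell a b" if "x \<noteq> Nul" for x
    using that by (cases x) auto
  then show "wp P \<rho> (If_Nul a b c) Q \<longleftrightarrow>
     wp P \<rho> a (\<lambda>x s. if x = Nul then wp P \<rho> b (\<lambda>y t. Q y (s + t + 1))
                              else wp P \<rho> c (\<lambda>y t. Q y (s + t + 1)))"
    unfolding wp_def by (fastforce intro: eval_evals.intros elim: eval_If_NulE split: if_splits)
qed (unfold wp_def wps_def wp_body_def;
     fastforce intro: eval_evals.intros
       elim: eval_ArgE eval_MkNulE eval_MkCellE eval_LeftE eval_RightE eval_CallE
         evals_NilE evals_ConsE)+

definition computes :: "program \<Rightarrow> nat \<Rightarrow> val list \<Rightarrow> val \<Rightarrow> nat \<Rightarrow> bool" where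
  "computes P f xs y T \<longleftrightarrow> wp P xs (P ! f) (\<lambda>x t. x = y \<and> t \<le> T)"

text \<open>Well defined by determinism once the call terminates; only upper bounds on it are ever
  used.\<close>

definition cost :: "program \<Rightarrow> nat \<Rightarrow> val list \<Rightarrow> nat" where
  "cost P f xs = (THE t. \<exists>y. eval P xs (P ! f) y t)"

text \<open>
  As a rewrite rule this turns a call into an upper bound on the opaque number \<open>cost P f xs\<close>, so
  that the simplifier executes a body symbolically and leaves a linear inequality between costs.
\<close>

lemma wp_computes:
  assumes "computes P f xs y T"
  shows "wp_body P f xs Q \<longleftrightarrow> (cost P f xs \<le> T \<longrightarrow> Q y (cost P f xs))"
proof -
  obtain t where t: "eval P xs (P ! f) y t" "t \<le> T"
    using assms by (auto simp: computes_def wp_def)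
  have "cost P f xs = t"
    unfolding cost_def using t(1) by (blast intro: the_equality dest: eval_deterministic(1))
  with t show ?thesis
    unfolding wp_body_def wp_def by (blast dest: eval_deterministic(1))
qed

lemma computes_mono: "computes P f xs y S \<Longrightarrow> S \<le> T \<Longrightarrow> computes P f xs y T"
  unfolding computes_def wp_def using order_trans by blast

section \<open>Arithmetic, bit vectors and table routines in the tree language\<close>

section \<open>The program\<close>

abbreviation (input) START :: nat where "START \<equiv> 1"
abbreviation (input) APPEND :: nat where "APPEND \<equiv> 2"
abbreviation (input) DOUBLE :: nat where "DOUBLE \<equiv> 3"
abbreviation (input) INC :: nat where "INC \<equiv> 4"
abbreviation (input) ADD :: nat where "ADD \<equiv> 5"
abbreviation (input) MUL :: nat where "MUL \<equiv> 6"
abbreviation (input) UNARY :: nat where "UNARY \<equiv> 7"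
abbreviation (input) EQ :: nat where "EQ \<equiv> 8"
abbreviation (input) OR :: nat where "OR \<equiv> 9"
abbreviation (input) BIT :: nat where "BIT \<equiv> 10"
abbreviation (input) CLEAR :: nat where "CLEAR \<equiv> 11"
abbreviation (input) SINGLE :: nat where "SINGLE \<equiv> 12"
abbreviation (input) RELABEL_ITEM :: nat where "RELABEL_ITEM \<equiv> 13"
abbreviation (input) RELABEL_STATE :: nat where "RELABEL_STATE \<equiv> 14"
abbreviation (input) RELABEL_TABLE :: nat where "RELABEL_TABLE \<equiv> 15"
abbreviation (input) CLASH :: nat where "CLASH \<equiv> 16"
abbreviation (input) JOIN_TABLE :: nat where "JOIN_TABLE \<equiv> 17"
abbreviation (input) MERGE :: nat where "MERGE \<equiv> 18"
abbreviation (input) INSERT :: nat where "INSERT \<equiv> 19"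
abbreviation (input) ROW :: nat where "ROW \<equiv> 20"
abbreviation (input) PRODUCT :: nat where "PRODUCT \<equiv> 21"
abbreviation (input) BLANKS :: nat where "BLANKS \<equiv> 22"
abbreviation (input) PREFIX :: nat where "PREFIX \<equiv> 23"
abbreviation (input) INTRO :: nat where "INTRO \<equiv> 24"
abbreviation (input) SOLVE :: nat where "SOLVE \<equiv> 25"
abbreviation (input) LEQ1 :: nat where "LEQ1 \<equiv> 26"
abbreviation (input) NEAR :: nat where "NEAR \<equiv> 27"
abbreviation (input) BALANCED :: nat where "BALANCED \<equiv> 28"
abbreviation (input) TOTAL :: nat where "TOTAL \<equiv> 29"

abbreviation (input) "ONE \<equiv> MkCell MkNul MkNul"

definition "start_tm =
  Call TOTAL [Call SOLVE [Call UNARY [Arg 0], Right (Arg 1)]]"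
definition "append_tm =
  If_Nul (Arg 0) (Arg 1)
    (MkCell (Left (Arg 0)) (Call APPEND [Right (Arg 0), Arg 1]))"
definition "double_tm =
  If_Nul (Arg 0) MkNul (MkCell MkNul (Arg 0))"
definition "inc_tm =
  If_Nul (Arg 0) (MkCell ONE MkNul)
    (If_Nul (Left (Arg 0)) (MkCell ONE (Right (Arg 0)))
      (MkCell MkNul (Call INC [Right (Arg 0)])))"
definition "add_tm =
  If_Nul (Arg 0) (Arg 1)
    (If_Nul (Arg 1) (Arg 0)
      (If_Nul (Left (Arg 0))
        (MkCell (Left (Arg 1)) (Call ADD [Right (Arg 0), Right (Arg 1)]))
        (If_Nul (Left (Arg 1))
          (MkCell ONE (Call ADD [Right (Arg 0), Right (Arg 1)]))
          (MkCell MkNul (Call INC [Call ADD [Right (Arg 0), Right (Arg 1)]])))))"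
definition "mul_tm =
  If_Nul (Arg 0) MkNul
    (If_Nul (Left (Arg 0))
      (Call DOUBLE [Call MUL [Right (Arg 0), Arg 1]])
      (Call ADD [Arg 1, Call DOUBLE [Call MUL [Right (Arg 0), Arg 1]]]))"
definition "unary_tm =
  If_Nul (Arg 0) MkNul
    (If_Nul (Left (Arg 0))
      (Call APPEND [Call UNARY [Right (Arg 0)], Call UNARY [Right (Arg 0)]])
      (MkCell MkNul (Call APPEND [Call UNARY [Right (Arg 0)], Call UNARY [Right (Arg 0)]])))"
definition "eq_tm =
  If_Nul (Arg 0) (If_Nul (Arg 1) ONE MkNul)
    (If_Nul (Arg 1) MkNul
      (If_Nul (Call EQ [Left (Arg 0), Left (Arg 1)]) MkNul
        (Call EQ [Right (Arg 0), Right (Arg 1)])))"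
definition "or_tm =
  If_Nul (Arg 0) (Arg 1)
    (If_Nul (Arg 1) (Arg 0)
      (MkCell (If_Nul (Left (Arg 0)) (Left (Arg 1)) (Left (Arg 0)))
        (Call OR [Right (Arg 0), Right (Arg 1)])))"
definition "bit_tm =
  If_Nul (Arg 0) (Left (Arg 1)) (Call BIT [Right (Arg 0), Right (Arg 1)])"
definition "clear_tm =
  If_Nul (Arg 1) MkNul
    (If_Nul (Arg 0) (MkCell MkNul (Right (Arg 1)))
      (MkCell (Left (Arg 1)) (Call CLEAR [Right (Arg 0), Right (Arg 1)])))"
definition "single_tm = Call APPEND [Arg 0, MkCell ONE MkNul]"
definition "relabel_item_tm =
  If_Nul (Call BIT [Arg 0, Left (Arg 2)]) (Arg 2)
    (MkCell (Call OR [Call SINGLE [Arg 1], Call CLEAR [Arg 0, Left (Arg 2)]]) (Right (Arg 2)))"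
definition "relabel_state_tm =
  If_Nul (Arg 2) MkNul
    (MkCell (Call RELABEL_ITEM [Arg 0, Arg 1, Left (Arg 2)])
      (Call RELABEL_STATE [Arg 0, Arg 1, Right (Arg 2)]))"
definition "relabel_table_tm =
  If_Nul (Arg 2) MkNul
    (MkCell (MkCell (Call RELABEL_STATE [Arg 0, Arg 1, Left (Left (Arg 2))])
                    (Right (Left (Arg 2))))
      (Call RELABEL_TABLE [Arg 0, Arg 1, Right (Arg 2)]))"
definition "clash_tm =
  If_Nul (Arg 2) MkNul
    (If_Nul (Call BIT [Arg 0, Left (Left (Arg 2))])
      (Call CLASH [Arg 0, Arg 1, Right (Arg 2)])
      (If_Nul (Call BIT [Arg 1, Left (Left (Arg 2))])
        (Call CLASH [Arg 0, Arg 1, Right (Arg 2)]) ONE))"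
definition "join_table_tm =
  If_Nul (Arg 2) MkNul
    (If_Nul (Call CLASH [Arg 0, Arg 1, Left (Left (Arg 2))])
      (MkCell (Left (Arg 2)) (Call JOIN_TABLE [Arg 0, Arg 1, Right (Arg 2)]))
      (Call JOIN_TABLE [Arg 0, Arg 1, Right (Arg 2)]))"
definition "merge_tm =
  If_Nul (Arg 0) MkNul
    (MkCell (MkCell (Call OR [Left (Left (Arg 0)), Left (Left (Arg 1))])
                    (Call APPEND [Right (Left (Arg 0)), Right (Left (Arg 1))]))
      (Call MERGE [Right (Arg 0), Right (Arg 1)]))"
definition "insert_tm =
  If_Nul (Arg 2) (MkCell (MkCell (Arg 0) (Arg 1)) MkNul)
    (If_Nul (Call EQ [Arg 0, Left (Left (Arg 2))])
      (MkCell (Left (Arg 2)) (Call INSERT [Arg 0, Arg 1, Right (Arg 2)]))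
      (MkCell (MkCell (Arg 0) (Call ADD [Arg 1, Right (Left (Arg 2))])) (Right (Arg 2))))"
definition "row_tm =
  If_Nul (Arg 1) (Arg 2)
    (Call ROW [Arg 0, Right (Arg 1),
      Call INSERT [Call MERGE [Left (Arg 0), Left (Left (Arg 1))],
        Call MUL [Right (Arg 0), Right (Left (Arg 1))], Arg 2]])"
definition "product_tm =
  If_Nul (Arg 0) (Arg 2)
    (Call PRODUCT [Right (Arg 0), Arg 1, Call ROW [Left (Arg 0), Arg 1, Arg 2]])"
definition "blanks_tm =
  If_Nul (Arg 0) MkNul (MkCell (MkCell MkNul MkNul) (Call BLANKS [Right (Arg 0)]))"
definition "prefix_tm =
  If_Nul (Arg 0) MkNul
    (MkCell (MkCell (MkCell (MkCell MkNul MkNul) (Left (Left (Arg 0)))) (Right (Left (Arg 0))))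
      (Call PREFIX [Right (Arg 0)]))"
definition "intro_tm =
  If_Nul (Arg 1) MkNul
    (MkCell (MkCell (MkCell (Arg 0) (Call BLANKS [Right (Arg 1)])) (MkCell ONE MkNul))
      (Call PREFIX [Call INTRO [Arg 0, Right (Arg 1)]]))"
text \<open>The tags 1, 2, 3 have the bits 1, 01, 11, least significant first, and 0 is
  \<open>Nul\<close>. An empty tail singles out 1, and the lowest bit then separates 2 from
  3.\<close>

definition "solve_tm =
  If_Nul (Left (Arg 1))
    (Call INTRO [MkCell (Call SINGLE [Call UNARY [Right (Arg 1)]]) ONE, Arg 0])
    (If_Nul (Right (Left (Arg 1)))
      (Call PRODUCT [Call SOLVE [Arg 0, Left (Right (Arg 1))],
        Call SOLVE [Arg 0, Right (Right (Arg 1))], MkNul])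
      (If_Nul (Left (Left (Arg 1)))
        (Call RELABEL_TABLE [Call UNARY [Left (Right (Arg 1))],
          Call UNARY [Left (Right (Right (Arg 1)))],
          Call SOLVE [Arg 0, Right (Right (Right (Arg 1)))]])
        (Call JOIN_TABLE [Call UNARY [Left (Right (Arg 1))],
          Call UNARY [Left (Right (Right (Arg 1)))],
          Call SOLVE [Arg 0, Right (Right (Right (Arg 1)))]])))"
definition "leq1_tm =
  If_Nul (Arg 0) ONE
    (If_Nul (Arg 1) (If_Nul (Right (Arg 0)) ONE MkNul)
      (Call LEQ1 [Right (Arg 0), Right (Arg 1)]))"
definition "near_tm =
  If_Nul (Arg 1) ONE
    (If_Nul (Call LEQ1 [Arg 0, Right (Left (Arg 1))]) MkNul
      (Call NEAR [Arg 0, Right (Arg 1)]))"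
definition "balanced_tm =
  If_Nul (Arg 0) ONE
    (If_Nul (Call NEAR [Right (Left (Arg 0)), Arg 1]) MkNul
      (Call BALANCED [Right (Arg 0), Arg 1]))"
definition "total_tm =
  If_Nul (Arg 0) MkNul
    (If_Nul (Call BALANCED [Left (Left (Arg 0)), Left (Left (Arg 0))])
      (Call TOTAL [Right (Arg 0)])
      (Call ADD [Right (Left (Arg 0)), Call TOTAL [Right (Arg 0)]]))"

text \<open>
  Entry \<open>0\<close> is left open: with \<open>k\<close> as an input and with \<open>k\<close> fixed, only the main function differs.
\<close>

definition prog :: "tm \<Rightarrow> program" where
  "prog main = [main, start_tm, append_tm, double_tm, inc_tm, add_tm, mul_tm, unary_tm, eq_tm,
     or_tm, bit_tm, clear_tm, single_tm, relabel_item_tm, relabel_state_tm, relabel_table_tm,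
     clash_tm, join_table_tm, merge_tm, insert_tm, row_tm, product_tm, blanks_tm, prefix_tm,
     intro_tm, solve_tm, leq1_tm, near_tm, balanced_tm, total_tm]"

lemma prog_nth [simp]:
  "length (prog m) = 30"
  "prog m ! 0 = m"
  "prog m ! START = start_tm"
  "prog m ! Suc 0 = start_tm"
  "prog m ! APPEND = append_tm"
  "prog m ! DOUBLE = double_tm"
  "prog m ! INC = inc_tm"
  "prog m ! ADD = add_tm"
  "prog m ! MUL = mul_tm"
  "prog m ! UNARY = unary_tm"
  "prog m ! EQ = eq_tm"
  "prog m ! OR = or_tm"
  "prog m ! BIT = bit_tm"
  "prog m ! CLEAR = clear_tm"
  "prog m ! SINGLE = single_tm"
  "prog m ! RELABEL_ITEM = relabel_item_tm"
  "prog m ! RELABEL_STATE = relabel_state_tm"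
  "prog m ! RELABEL_TABLE = relabel_table_tm"
  "prog m ! CLASH = clash_tm"
  "prog m ! JOIN_TABLE = join_table_tm"
  "prog m ! MERGE = merge_tm"
  "prog m ! INSERT = insert_tm"
  "prog m ! ROW = row_tm"
  "prog m ! PRODUCT = product_tm"
  "prog m ! BLANKS = blanks_tm"
  "prog m ! PREFIX = prefix_tm"
  "prog m ! INTRO = intro_tm"
  "prog m ! SOLVE = solve_tm"
  "prog m ! LEQ1 = leq1_tm"
  "prog m ! NEAR = near_tm"
  "prog m ! BALANCED = balanced_tm"
  "prog m ! TOTAL = total_tm"
  by (simp_all add: prog_def)

section \<open>Binary and unary numbers, equality of trees\<close>

section \<open>Basic data\<close>

lemma enc_bool_simps [simp]: "enc_bool True = Cell Nul Nul" "enc_bool False = Nul"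
  by (simp_all add: enc_bool_def)

lemma enc_bool_eq_Nul [simp]: "enc_bool b = Nul \<longleftrightarrow> \<not> b"
  by (simp add: enc_bool_def)

lemma enc_list_eq_Nul [simp]: "enc_list xs = Nul \<longleftrightarrow> xs = []"
  by (cases xs) auto

lemma enc_nat_0 [simp]: "enc_nat 0 = Nul"
  by (simp add: enc_nat.simps)

text \<open>With the argument written as \<open>2 * n + of_bool b\<close>, one rule serves both
  parities; the exceptional case keeps out leading zeros.\<close>

lemma enc_nat_bit [simp]:
  "enc_nat (2 * n + of_bool b) = (if n = 0 \<and> \<not> b then Nul else Cell (enc_bool b) (enc_nat n))"
  by (subst enc_nat.simps) auto

lemma enc_nat_pos: "0 < n \<Longrightarrow> enc_nat n = Cell (enc_bool (odd n)) (enc_nat (n div 2))"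
  by (subst enc_nat.simps) auto

lemma enc_nat_eq_Nul [simp]: "enc_nat n = Nul \<longleftrightarrow> n = 0"
  by (subst enc_nat.simps) auto

lemma nat_bitE:
  fixes n :: nat
  obtains m b where "n = 2 * m + of_bool b"
proof
  show "n = 2 * (n div 2) + of_bool (odd n)" by (cases "odd n") auto
qed

abbreviation enc_unary :: "nat \<Rightarrow> val" where
  "enc_unary n \<equiv> enc_list (replicate n Nul)"

abbreviation enc_bits :: "bool list \<Rightarrow> val" where
  "enc_bits bs \<equiv> enc_list (map enc_bool bs)"

text \<open>Only the first argument is traversed. Here and below the numerals are generous step
  counts, chosen so that arithmetic closes the recursion.\<close>

lemma append_computes:
  "computes (prog m) APPEND [enc_list xs, enc_list ys] (enc_list (xs @ ys)) (10 * length xs + 10)"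
proof (induction xs)
  case Nil
  show ?case by (simp add: computes_def append_tm_def)
next
  case (Cons x xs)
  show ?case by (simp add: computes_def append_tm_def wp_computes[OF Cons.IH])
qed

lemma double_computes: "computes (prog m) DOUBLE [enc_nat n] (enc_nat (2 * n)) 10"
  using enc_nat_bit[of n False] by (auto simp: computes_def double_tm_def enc_bool_def)

lemma inc_computes:
  assumes "n < 2 ^ B"
  shows "computes (prog m) INC [enc_nat n] (enc_nat (Suc n)) (20 * B + 20)"
  using assms
proof (induction B arbitrary: n)
  case 0
  then show ?case by (simp add: computes_def inc_tm_def enc_nat_pos enc_bool_def)
next
  case (Suc B)
  obtain k b where n: "n = 2 * k + of_bool b" by (rule nat_bitE)
  with Suc.prems have "k < 2 ^ B" by auto
  note IH = wp_computes[OF Suc.IH[OF this]]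
  show ?case
  proof (cases b)
    case True
    have "Suc n = 2 * Suc k + of_bool False" using n True by simp
    then have "enc_nat (Suc n) = Cell Nul (enc_nat (Suc k))"
      by (simp only: enc_nat_bit) (simp add: enc_bool_def)
    then show ?thesis
      using True by (simp only: n enc_nat_bit) (simp add: computes_def inc_tm_def IH)
  next
    case False
    have "Suc n = 2 * k + of_bool True" using n False by simp
    then have "enc_nat (Suc n) = Cell (Cell Nul Nul) (enc_nat k)"
      by (simp only: enc_nat_bit) (simp add: enc_bool_def)
    then show ?thesis
      using False by (simp only: n enc_nat_bit) (simp add: computes_def inc_tm_def)
  qed
qed

text \<open>Two set lowest bits call \<open>INC\<close> on the sum of the halves; a linear cost on
  each of \<open>B\<close> levels gives the square.\<close>

lemma add_computes:
  assumes "x < 2 ^ B" "y < 2 ^ B"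
  shows "computes (prog m) ADD [enc_nat x, enc_nat y] (enc_nat (x + y)) (100 * (B + 1)\<^sup>2)"
  using assms
proof (induction B arbitrary: x y)
  case 0
  then show ?case by (simp add: computes_def add_tm_def)
next
  case (Suc B)
  obtain k a where x: "x = 2 * k + of_bool a" by (rule nat_bitE)
  obtain l b where y: "y = 2 * l + of_bool b" by (rule nat_bitE)
  have kl: "k < 2 ^ B" "l < 2 ^ B" using x y Suc.prems by auto
  \<comment> \<open>The sum of the halves may need one bit more, hence \<open>INC\<close> is charged
    for \<open>Suc B\<close> bits.\<close>
  then have "k + l < 2 ^ Suc B" by simp
  note IH = wp_computes[OF Suc.IH[OF kl]] wp_computes[OF inc_computes[OF this]]
  show ?case
  proof (cases "x = 0 \<or> y = 0")
    case True
    then show ?thesis by (auto simp: computes_def add_tm_def power2_eq_square)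
  next
    case False
    then have xy: "enc_nat x = Cell (enc_bool a) (enc_nat k)"
      "enc_nat y = Cell (enc_bool b) (enc_nat l)"
      unfolding x y enc_nat_bit by auto
    have "x + y = 2 * (k + l + of_bool (a \<and> b)) + of_bool (a \<noteq> b)"
      using x y by auto
    then have s: "enc_nat (x + y) = Cell (enc_bool (a \<noteq> b)) (enc_nat (k + l + of_bool (a \<and> b)))"
      using False x y by (simp only: enc_nat_bit) auto
    have "100 * (B + 1)\<^sup>2 + 20 * Suc B + 100 \<le> 100 * (Suc B + 1)\<^sup>2"
      by (simp add: power2_eq_square)
    then show ?thesis unfolding xy s
      by (cases a; cases b) (simp_all add: computes_def add_tm_def IH enc_bool_def)
  qed
qed

text \<open>\<open>D\<close> bounds the bits of all intermediate results, so each of the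
  \<open>A\<close> rounds pays for at most one addition of \<open>D\<close>-bit numbers.\<close>

lemma mul_computes:
  assumes "x < 2 ^ A" "y < 2 ^ B" "A + B \<le> D"
  shows "computes (prog m) MUL [enc_nat x, enc_nat y] (enc_nat (x * y))
    ((A + 1) * (100 * (D + 1)\<^sup>2 + 60))"
  using assms
proof (induction A arbitrary: x)
  case 0
  then show ?case by (simp add: computes_def mul_tm_def)
next
  case (Suc A)
  obtain k a where x: "x = 2 * k + of_bool a" by (rule nat_bitE)
  have k: "k < 2 ^ A" using x Suc.prems by auto
  have "y < 2 ^ D"
    using Suc.prems
    by (meson le_add2 order_trans order_less_le_trans one_le_numeral power_increasing)
  moreover have "2 * (k * y) < 2 ^ D"
  proof (cases "y = 0")
    case False
    have "2 * (k * y) \<le> 2 * (2 ^ A * y)" using k by simp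
    also have "\<dots> < 2 ^ Suc A * 2 ^ B" using Suc.prems by simp
    also have "\<dots> \<le> 2 ^ D" using Suc.prems by (simp flip: power_add power_Suc)
    finally show ?thesis .
  qed simp
  moreover have "A + B \<le> D" using Suc.prems by simp
  ultimately have "computes (prog m) MUL [enc_nat k, enc_nat y] (enc_nat (k * y))
      ((A + 1) * (100 * (D + 1)\<^sup>2 + 60))"
    and "computes (prog m) ADD [enc_nat y, enc_nat (2 * (k * y))] (enc_nat (y + 2 * (k * y)))
      (100 * (D + 1)\<^sup>2)"
    using Suc k by (blast intro: add_computes)+
  note IH = this[THEN wp_computes]
  show ?case
  proof (cases "x = 0")
    case True
    then show ?thesis by (auto simp: computes_def mul_tm_def)
  next
    case False
    then have "enc_nat x = Cell (enc_bool a) (enc_nat k)"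
      unfolding x enc_nat_bit by auto
    moreover have "x * y = (if a then y + 2 * (k * y) else 2 * (k * y))"
      using x by auto
    ultimately show ?thesis
      by (cases a) (auto simp: computes_def mul_tm_def mult.assoc IH wp_computes[OF double_computes])
  qed
qed

text \<open>The half is evaluated twice, so the time is polynomial in the value \<open>n\<close> and
  not in its length. This is affordable because only \<open>k\<close> and labels are
  converted.\<close>

lemma unary_computes:
  "computes (prog m) UNARY [enc_nat n] (enc_unary n) (200 * n\<^sup>2 + 10)"
proof (induction n rule: less_induct)
  case (less n)
  show ?case
  proof (cases "n = 0")
    case True
    then show ?thesis by (simp add: computes_def unary_tm_def)
  next
    case False
    obtain k b where n: "n = 2 * k + of_bool b" by (rule nat_bitE)
    with False have "k < n" by auto
    have nat: "enc_nat n = Cell (enc_bool b) (enc_nat k)"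
      unfolding n enc_nat_bit using False n by auto
    have rep: "replicate n Nul = (if b then [Nul] else []) @ replicate k Nul @ replicate k Nul"
      unfolding n by (auto simp flip: replicate_add simp: mult_2)
    \<comment> \<open>Doubling \<open>n\<close> multiplies the bound by four, while only two
      recursive calls are made; the slack pays for the append. For \<open>k = 0\<close> the number
      is \<open>n = 1\<close>.\<close>
    have "0 < k \<Longrightarrow> k * 10 + 50 \<le> k * (k * 400)"
      by (rule order_trans[of _ "k * 60"]) (auto simp: Suc_le_eq)
    then have "400 * k\<^sup>2 + 10 * k + 60 \<le> 200 * n\<^sup>2 + 10"
      using False n by (auto simp: power2_eq_square algebra_simps)
    then show ?thesis unfolding nat rep
      using False n by (cases b) (auto simp: computes_def unary_tm_def
        wp_computes[OF less[OF \<open>k < n\<close>]] wp_computes[OF append_computes])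
  qed
qed

text \<open>The comparison stops at the first difference, so the first tree alone bounds the
  cost.\<close>

lemma eq_computes:
  "computes (prog m) EQ [x, y] (enc_bool (x = y)) (30 * size x + 10)"
proof (induction x arbitrary: y)
  case Nul
  show ?case by (simp add: computes_def eq_tm_def enc_bool_def)
next
  case (Cell x1 x2)
  show ?case
  proof (cases y)
    case Nul
    then show ?thesis by (simp add: computes_def eq_tm_def enc_bool_def)
  next
    case (Cell y1 y2)
    show ?thesis unfolding Cell
      by (simp add: computes_def eq_tm_def wp_computes[OF Cell.IH(1)] wp_computes[OF Cell.IH(2)])
  qed
qed

section \<open>Color classes as bit vectors with unary sizes\<close>

section \<open>States\<close>

text \<open>
  An item describes one color class: a bit vector, indexed by labels, of the labels that occur
  in it, and its cardinality. Bit vectors may have trailing zeros, so a set of labels has several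
  representations. A state is a list of items, one for each color.
\<close>

type_synonym item = "bool list \<times> nat"
type_synonym table = "(item list \<times> nat) list"

definition bit_at :: "bool list \<Rightarrow> nat \<Rightarrow> bool" where
  "bit_at b i \<longleftrightarrow> i < length b \<and> b ! i"

fun or_bits :: "bool list \<Rightarrow> bool list \<Rightarrow> bool list" where
  "or_bits [] ys = ys"
| "or_bits xs [] = xs"
| "or_bits (x # xs) (y # ys) = (x \<or> y) # or_bits xs ys"

definition single_bit :: "nat \<Rightarrow> bool list" where
  "single_bit i = replicate i False @ [True]"

definition relabel_item :: "nat \<Rightarrow> nat \<Rightarrow> item \<Rightarrow> item" where
  "relabel_item i j x =
     (if bit_at (fst x) i then (or_bits (single_bit j) ((fst x)[i := False]), snd x) else x)"

definition clash :: "nat \<Rightarrow> nat \<Rightarrow> item list \<Rightarrow> bool" where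
  "clash i j s \<longleftrightarrow> (\<exists>x\<in>set s. bit_at (fst x) i \<and> bit_at (fst x) j)"

definition merge_item :: "item \<Rightarrow> item \<Rightarrow> item" where
  "merge_item x y = (or_bits (fst x) (fst y), snd x + snd y)"

definition merge :: "item list \<Rightarrow> item list \<Rightarrow> item list" where
  "merge s s' = map2 merge_item s s'"

text \<open>Over ordered pairs, the one-sided inequality amounts to absolute differences of at most
  1.\<close>

definition balanced :: "item list \<Rightarrow> bool" where
  "balanced s \<longleftrightarrow> (\<forall>x\<in>set s. \<forall>y\<in>set s. snd x \<le> snd y + 1)"

definition enc_item :: "item \<Rightarrow> val" where
  "enc_item x = Cell (enc_bits (fst x)) (enc_unary (snd x))"

abbreviation enc_state :: "item list \<Rightarrow> val" where
  "enc_state s \<equiv> enc_list (map enc_item s)"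

lemma components_enc_item [simp]:
  "left_of (enc_item x) = enc_bits (fst x)"
  "right_of (enc_item x) = enc_unary (snd x)"
  by (simp_all add: enc_item_def)

lemma enc_merge_item:
  "enc_item (merge_item x y) =
     Cell (enc_bits (or_bits (fst x) (fst y))) (enc_unary (snd x + snd y))"
  by (simp add: enc_item_def merge_item_def)

lemma merge_Cons: "merge (x # s) (y # s') = merge_item x y # merge s s'"
  by (simp add: merge_def)

lemma or_bits_Nil2 [simp]: "or_bits xs [] = xs"
  by (cases xs) auto

lemma bit_at_simps [simp]:
  "\<not> bit_at [] i"
  "bit_at (b # bs) 0 \<longleftrightarrow> b"
  "bit_at (b # bs) (Suc i) \<longleftrightarrow> bit_at bs i"
  by (auto simp: bit_at_def)

lemma bit_at_or_bits [simp]: "bit_at (or_bits xs ys) i \<longleftrightarrow> bit_at xs i \<or> bit_at ys i"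
proof (induction xs ys arbitrary: i rule: or_bits.induct)
  case (3 x xs y ys)
  then show ?case by (cases i) auto
qed auto

lemma bit_at_single_bit [simp]: "bit_at (single_bit j) i \<longleftrightarrow> i = j"
  by (auto simp: bit_at_def single_bit_def nth_append)

lemma bit_at_clear [simp]: "bit_at (b[i := False]) j \<longleftrightarrow> bit_at b j \<and> j \<noteq> i"
  by (cases "i < length b") (auto simp: bit_at_def nth_list_update)

lemma length_or_bits [simp]: "length (or_bits xs ys) = max (length xs) (length ys)"
  by (induction xs ys rule: or_bits.induct) auto

lemma length_single_bit [simp]: "length (single_bit i) = Suc i"
  by (simp add: single_bit_def)

lemma enc_list_inject [simp]: "enc_list xs = enc_list ys \<longleftrightarrow> xs = ys"
proof (induction xs arbitrary: ys)
  case Nil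
  show ?case by (cases ys) auto
next
  case (Cons x xs)
  then show ?case by (cases ys) auto
qed

text \<open>\<open>EQ\<close> compares encodings; injectivity makes this a comparison of states,
  where vectors differing in trailing zeros count as different.\<close>

lemma map_enc_item_inject [simp]: "map enc_item s = map enc_item s' \<longleftrightarrow> s = s'"
proof -
  have "inj enc_bool" by (auto simp: inj_def enc_bool_def)
  then have "inj enc_item"
    by (intro injI) (auto simp: enc_item_def prod_eq_iff inj_map_eq_map)
  then show ?thesis by (simp add: inj_map_eq_map)
qed

lemma or_computes:
  "computes (prog m) OR [enc_bits xs, enc_bits ys] (enc_bits (or_bits xs ys)) (20 * length xs + 10)"
proof (induction xs ys rule: or_bits.induct)
  case (3 x xs y ys)
  show ?case
    by (cases x; cases y) (simp_all add: computes_def or_tm_def wp_computes[OF 3])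
qed (simp_all add: computes_def or_tm_def)

lemma bit_computes:
  "computes (prog m) BIT [enc_unary i, enc_bits b] (enc_bool (bit_at b i)) (10 * i + 10)"
proof (induction i arbitrary: b)
  case 0
  show ?case by (cases b) (simp_all add: computes_def bit_tm_def)
next
  case (Suc i)
  show ?case
  proof (cases b)
    \<comment> \<open>Beyond the end both components of \<open>Nul\<close> are \<open>Nul\<close>
      again, which reads as an unset bit.\<close>
    case Nil
    then show ?thesis
      using wp_computes[OF Suc[of "[]"]] by (simp add: computes_def bit_tm_def)
  next
    case (Cons x b')
    then show ?thesis by (simp add: computes_def bit_tm_def wp_computes[OF Suc])
  qed
qed

lemma clear_computes:
  "computes (prog m) CLEAR [enc_unary i, enc_bits b] (enc_bits (b[i := False])) (15 * i + 10)"
proof (induction i arbitrary: b)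
  case 0
  show ?case by (cases b) (simp_all add: computes_def clear_tm_def)
next
  case (Suc i)
  show ?case
    by (cases b) (simp_all add: computes_def clear_tm_def wp_computes[OF Suc])
qed

lemma single_computes:
  "computes (prog m) SINGLE [enc_unary i] (enc_bits (single_bit i)) (10 * i + 20)"
proof -
  note append = append_computes[of m "replicate i Nul" "[Cell Nul Nul]", simplified]
  show ?thesis
    by (simp add: computes_def single_tm_def wp_computes[OF append] single_bit_def)
qed

text \<open>The bound is free of the length of the vector: \<open>OR\<close> is charged to its first
  argument, here \<open>single_bit j\<close>, and \<open>CLEAR\<close> stops at position
  \<open>i\<close>.\<close>

lemma relabel_item_computes:
  "computes (prog m) RELABEL_ITEM [enc_unary i, enc_unary j, enc_item x]
     (enc_item (relabel_item i j x)) (100 * (i + j + 1))"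
  by (simp add: computes_def relabel_item_tm_def enc_item_def relabel_item_def
      wp_computes[OF bit_computes] wp_computes[OF single_computes] wp_computes[OF clear_computes]
      wp_computes[OF or_computes])

lemma relabel_state_computes:
  "computes (prog m) RELABEL_STATE [enc_unary i, enc_unary j, enc_state s]
     (enc_state (map (relabel_item i j) s)) (length s * (100 * (i + j + 1) + 20) + 10)"
proof (induction s)
  case Nil
  show ?case by (simp add: computes_def relabel_state_tm_def)
next
  case (Cons x s)
  show ?case
    by (simp add: computes_def relabel_state_tm_def wp_computes[OF Cons]
        wp_computes[OF relabel_item_computes])
qed

lemma clash_computes:
  "computes (prog m) CLASH [enc_unary i, enc_unary j, enc_state s]
     (enc_bool (clash i j s)) (length s * (10 * (i + j) + 60) + 10)"
proof (induction s)
  case Nil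
  show ?case by (simp add: computes_def clash_tm_def clash_def)
next
  case (Cons x s)
  have "clash i j (x # s) \<longleftrightarrow> bit_at (fst x) i \<and> bit_at (fst x) j \<or> clash i j s"
    by (auto simp: clash_def)
  then show ?case
    by (simp add: computes_def clash_tm_def wp_computes[OF Cons] wp_computes[OF bit_computes])
qed

text \<open>Bounds on \<open>s\<close> suffice, as \<open>OR\<close> and \<open>APPEND\<close> are
  charged to their first argument.\<close>

lemma merge_computes:
  assumes "length s = length s'" "\<forall>x\<in>set s. length (fst x) \<le> D \<and> snd x \<le> D"
  shows "computes (prog m) MERGE [enc_state s, enc_state s'] (enc_state (merge s s'))
    (length s * (30 * D + 80) + 10)"
  using assms
proof (induction s s' rule: list_induct2)
  case Nil
  show ?case by (simp add: computes_def merge_tm_def merge_def)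
next
  case (Cons x s x' s')
  then have "computes (prog m) MERGE [enc_state s, enc_state s'] (enc_state (merge s s'))
    (length s * (30 * D + 80) + 10)" by simp
  note IH = wp_computes[OF this]
  from Cons.prems show ?case
    by (simp add: computes_def merge_tm_def IH enc_merge_item merge_Cons
        wp_computes[OF or_computes] wp_computes[OF append_computes] flip: replicate_add)
qed

lemma leq1_computes:
  "computes (prog m) LEQ1 [enc_unary x, enc_unary y] (enc_bool (x \<le> y + 1)) (20 * x + 20)"
proof (induction x arbitrary: y)
  case 0
  show ?case by (simp add: computes_def leq1_tm_def)
next
  case (Suc x)
  show ?case
  proof (cases y)
    case 0
    then show ?thesis by (simp add: computes_def leq1_tm_def)
  next
    case y: (Suc y')
    show ?thesis by (simp add: y computes_def leq1_tm_def wp_computes[OF Suc])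
  qed
qed

lemma near_computes:
  "computes (prog m) NEAR [enc_unary c, enc_state s] (enc_bool (\<forall>y\<in>set s. c \<le> snd y + 1))
     (length s * (20 * c + 50) + 10)"
proof (induction s)
  case Nil
  show ?case by (simp add: computes_def near_tm_def)
next
  case (Cons y s)
  show ?case
    by (simp add: computes_def near_tm_def wp_computes[OF Cons] wp_computes[OF leq1_computes])
qed

lemma balanced_computes:
  assumes "\<forall>x\<in>set s. snd x \<le> D"
  shows "computes (prog m) BALANCED [enc_state s, enc_state s']
    (enc_bool (\<forall>x\<in>set s. \<forall>y\<in>set s'. snd x \<le> snd y + 1))
    (length s * (length s' * (20 * D + 50) + 50) + 10)"
  using assms
proof (induction s)
  case Nil
  show ?case by (simp add: computes_def balanced_tm_def)
next
  case (Cons x s)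
  have near: "computes (prog m) NEAR [enc_unary (snd x), enc_state s']
      (enc_bool (\<forall>y\<in>set s'. snd x \<le> snd y + 1)) (length s' * (20 * D + 50) + 10)"
    by (rule computes_mono[OF near_computes]) (use Cons.prems in simp)
  show ?case
    by (simp add: computes_def balanced_tm_def wp_computes[OF Cons.IH] Cons.prems wp_computes[OF near])
      (fastforce simp: enc_bool_def)
qed

text \<open>A bit takes at most two cells, a unary unit one, and each item two more: one for the
  pair and one for the list.\<close>

lemma size_enc_state:
  assumes "\<forall>x\<in>set s. length (fst x) \<le> D \<and> snd x \<le> D"
  shows "size (enc_state s) \<le> length s * (3 * D + 2)"
proof -
  have unary: "size (enc_unary n) = n" for n
    by (induction n) auto
  have bits: "size (enc_bits b) \<le> 2 * length b" for b
    by (induction b) (auto simp: enc_bool_def)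
  have "size (enc_item x) \<le> 3 * D + 1" if "x \<in> set s" for x
    using assms that bits[of "fst x"] by (force simp: enc_item_def unary)
  then show ?thesis
  proof (induction s)
    case (Cons x s)
    from Cons.prems[of x] Cons.IH[OF Cons.prems] show ?case by simp
  qed simp
qed

section \<open>Tables of multiplicities and the cost of their operations\<close>

section \<open>Tables\<close>

text \<open>
  A table is a list of pairs of a state and a multiplicity; it stands for the sum of its entries,
  so that it does no harm if several of them represent the same label sets and cardinalities.
\<close>

definition relabel_table :: "nat \<Rightarrow> nat \<Rightarrow> table \<Rightarrow> table" where
  "relabel_table i j T = map (apfst (map (relabel_item i j))) T"

definition join_table :: "nat \<Rightarrow> nat \<Rightarrow> table \<Rightarrow> table" where
  "join_table i j T = filter (\<lambda>e. \<not> clash i j (fst e)) T"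

fun insert_entry :: "'k \<Rightarrow> nat \<Rightarrow> ('k \<times> nat) list \<Rightarrow> ('k \<times> nat) list" where
  "insert_entry s c [] = [(s, c)]"
| "insert_entry s c (e # T) =
     (if s = fst e then (s, c + snd e) # T else e # insert_entry s c T)"

fun row :: "item list \<times> nat \<Rightarrow> table \<Rightarrow> table \<Rightarrow> table" where
  "row e [] acc = acc"
| "row e (e' # T) acc = row e T (insert_entry (merge (fst e) (fst e')) (snd e * snd e') acc)"

fun product_table :: "table \<Rightarrow> table \<Rightarrow> table \<Rightarrow> table" where
  "product_table [] T acc = acc"
| "product_table (e # T') T acc = product_table T' T (row e T acc)"

text \<open>The colorings of a single vertex: the first color takes it, or an empty first class
  precedes a coloring with one color less.\<close>

fun intro_table :: "item \<Rightarrow> nat \<Rightarrow> table" where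
  "intro_table x 0 = []"
| "intro_table x (Suc k) =
     (x # replicate k ([], 0), 1) # map (apfst (Cons ([], 0))) (intro_table x k)"

text \<open>It dominates every multiplicity, so a bound on it bounds the bit lengths.\<close>

definition total :: "('k \<times> nat) list \<Rightarrow> nat" where
  "total T = sum_list (map snd T)"

definition total_balanced :: "table \<Rightarrow> nat" where
  "total_balanced T = (\<Sum>(s, c)\<leftarrow>T. if balanced s then c else 0)"

definition enc_entry :: "item list \<times> nat \<Rightarrow> val" where
  "enc_entry e = Cell (enc_state (fst e)) (enc_nat (snd e))"

abbreviation enc_table :: "table \<Rightarrow> val" where
  "enc_table T \<equiv> enc_list (map enc_entry T)"

definition states :: "nat \<Rightarrow> nat \<Rightarrow> nat \<Rightarrow> item list set" where
  "states k L N = {s. length s = k \<and> (\<forall>x\<in>set s. length (fst x) \<le> L \<and> snd x \<le> N)}"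

lemma states_mono: "L \<le> L' \<Longrightarrow> N \<le> N' \<Longrightarrow> states k L N \<subseteq> states k L' N'"
  by (force simp: states_def)

lemma components_enc_entry [simp]:
  "left_of (enc_entry e) = enc_state (fst e)"
  "right_of (enc_entry e) = enc_nat (snd e)"
  by (simp_all add: enc_entry_def)

lemma total_simps [simp]: "total [] = 0" "total (e # T) = snd e + total T"
  by (simp_all add: total_def)

lemma total_insert_entry [simp]: "total (insert_entry s c T) = c + total T"
  by (induction T) auto

lemma keys_insert_entry [simp]: "fst ` set (insert_entry s c T) = insert s (fst ` set T)"
  by (induction T) auto

lemma distinct_insert_entry:
  "distinct (map fst T) \<Longrightarrow> distinct (map fst (insert_entry s c T))"
proof (induction T)
  case (Cons e T)
  then show ?case
    using keys_insert_entry[of s c T] by (auto simp del: keys_insert_entry)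
qed simp

lemma relabel_table_computes:
  assumes "\<forall>e\<in>set T. length (fst e) = k"
  shows "computes (prog m) RELABEL_TABLE [enc_unary i, enc_unary j, enc_table T]
     (enc_table (relabel_table i j T)) (length T * (k * (100 * (i + j + 1) + 20) + 60) + 10)"
  using assms
proof (induction T)
  case Nil
  show ?case by (simp add: computes_def relabel_table_tm_def relabel_table_def)
next
  case (Cons e T)
  have "computes (prog m) RELABEL_STATE [enc_unary i, enc_unary j, enc_state (fst e)]
     (enc_state (map (relabel_item i j) (fst e))) (k * (100 * (i + j + 1) + 20) + 10)"
    using relabel_state_computes[of m i j "fst e"] Cons.prems by simp
  note this[THEN wp_computes]
  moreover have "computes (prog m) RELABEL_TABLE [enc_unary i, enc_unary j, enc_table T]
     (enc_table (relabel_table i j T)) (length T * (k * (100 * (i + j + 1) + 20) + 60) + 10)"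
    using Cons by simp
  note this[THEN wp_computes]
  moreover have "enc_table (relabel_table i j (e # T)) =
      Cell (Cell (enc_state (map (relabel_item i j) (fst e))) (enc_nat (snd e)))
        (enc_table (relabel_table i j T))"
    by (simp add: relabel_table_def enc_entry_def)
  ultimately show ?case
    by (simp add: computes_def relabel_table_tm_def)
qed

lemma join_table_computes:
  assumes "\<forall>e\<in>set T. length (fst e) = k"
  shows "computes (prog m) JOIN_TABLE [enc_unary i, enc_unary j, enc_table T]
     (enc_table (join_table i j T)) (length T * (k * (10 * (i + j) + 60) + 60) + 10)"
  using assms
proof (induction T)
  case Nil
  show ?case by (simp add: computes_def join_table_tm_def join_table_def)
next
  case (Cons e T)
  have "computes (prog m) CLASH [enc_unary i, enc_unary j, enc_state (fst e)]
     (enc_bool (clash i j (fst e))) (k * (10 * (i + j) + 60) + 10)"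
    using clash_computes[of m i j "fst e"] Cons.prems by simp
  note this[THEN wp_computes]
  moreover have "computes (prog m) JOIN_TABLE [enc_unary i, enc_unary j, enc_table T]
     (enc_table (join_table i j T)) (length T * (k * (10 * (i + j) + 60) + 60) + 10)"
    using Cons by simp
  note this[THEN wp_computes]
  moreover have "enc_table (join_table i j (e # T)) = (if clash i j (fst e)
      then enc_table (join_table i j T) else Cell (enc_entry e) (enc_table (join_table i j T)))"
    by (simp add: join_table_def)
  ultimately show ?case
    by (simp add: computes_def join_table_tm_def)
qed

text \<open>\<open>EQ\<close> runs at most once per entry, but \<open>ADD\<close> at most once in
  all: the scan ends at the first matching key.\<close>

lemma insert_computes:
  assumes "c < 2 ^ B" "\<forall>e\<in>set T. snd e < 2 ^ B"
  shows "computes (prog m) INSERT [enc_state s, enc_nat c, enc_table T]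
     (enc_table (insert_entry s c T))
     (length T * (30 * size (enc_state s) + 50) + 100 * (B + 1)\<^sup>2 + 50)"
  using assms
proof (induction T)
  case Nil
  show ?case by (simp add: computes_def insert_tm_def enc_entry_def)
next
  case (Cons e T)
  have "computes (prog m) INSERT [enc_state s, enc_nat c, enc_table T]
     (enc_table (insert_entry s c T))
     (length T * (30 * size (enc_state s) + 50) + 100 * (B + 1)\<^sup>2 + 50)"
    using Cons by simp
  note this[THEN wp_computes]
  moreover have "computes (prog m) ADD [enc_nat c, enc_nat (snd e)]
     (enc_nat (c + snd e)) (100 * (B + 1)\<^sup>2)"
    using Cons.prems by (intro add_computes) auto
  note this[THEN wp_computes]
  \<comment> \<open>\<open>enc_entry\<close> is unfolded at explicit pairs only; at the variable
    \<open>e\<close> the projection rules apply.\<close>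
  ultimately show ?case
    by (simp add: computes_def insert_tm_def wp_computes[OF eq_computes] enc_entry_def[of "(_, _)"])
qed

lemma blanks_computes:
  "computes (prog m) BLANKS [enc_unary k] (enc_state (replicate k ([], 0))) (10 * k + 10)"
proof (induction k)
  case 0
  show ?case by (simp add: computes_def blanks_tm_def)
next
  case (Suc k)
  show ?case
    by (simp add: computes_def blanks_tm_def wp_computes[OF Suc[unfolded map_replicate]] 
        enc_item_def[of "([], 0)"])
qed

lemma prefix_computes:
  "computes (prog m) PREFIX [enc_table T] (enc_table (map (apfst (Cons ([], 0))) T))
     (30 * length T + 10)"
proof (induction T)
  case Nil
  show ?case by (simp add: computes_def prefix_tm_def)
next
  case (Cons e T)
  show ?case
    by (simp add: computes_def prefix_tm_def wp_computes[OF Cons[unfolded map_map]]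
        enc_entry_def[of "apfst _ _"] enc_item_def[of "([], 0)"])
qed

lemma length_intro_table [simp]: "length (intro_table x k) = k"
  by (induction k) auto

lemma intro_computes:
  "computes (prog m) INTRO [enc_item x, enc_unary k] (enc_table (intro_table x k))
     (k * (40 * k + 60) + 10)"
proof (induction k)
  case 0
  show ?case by (simp add: computes_def intro_tm_def)
next
  case (Suc k)
  have "enc_nat 1 = Cell (Cell Nul Nul) Nul"
    by (simp add: enc_nat_pos)
  then show ?case
    by (simp add: computes_def intro_tm_def wp_computes[OF Suc] 
        wp_computes[OF prefix_computes[unfolded map_map]]
        wp_computes[OF blanks_computes[unfolded map_replicate]] enc_entry_def[of "(_, _)"]
        algebra_simps)
qed

lemma total_computes:
  assumes "\<forall>e\<in>set T. fst e \<in> states k D D" "total T < 2 ^ D"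
  shows "computes (prog m) TOTAL [enc_table T] (enc_nat (total_balanced T))
    (length T * (k * (k * (20 * D + 50) + 50) + 100 * (D + 1)\<^sup>2 + 60) + 10)"
  using assms
proof (induction T)
  case Nil
  show ?case by (simp add: computes_def total_tm_def total_balanced_def)
next
  case (Cons e T)
  have "computes (prog m) BALANCED [enc_state (fst e), enc_state (fst e)]
    (enc_bool (balanced (fst e))) (k * (k * (20 * D + 50) + 50) + 10)"
    using balanced_computes[of "fst e" D m "fst e"] Cons.prems by (auto simp: states_def balanced_def)
  note this[THEN wp_computes]
  moreover have "computes (prog m) TOTAL [enc_table T] (enc_nat (total_balanced T))
    (length T * (k * (k * (20 * D + 50) + 50) + 100 * (D + 1)\<^sup>2 + 60) + 10)"
    using Cons by simp
  note this[THEN wp_computes]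
  \<comment> \<open>Balanced entries are some of all entries, so partial sums stay below
    \<open>2 ^ D\<close>.\<close>
  moreover have "total_balanced T \<le> total T"
    unfolding total_balanced_def total_def by (induction T) auto
  then have "computes (prog m) ADD [enc_nat (snd e), enc_nat (total_balanced T)]
     (enc_nat (snd e + total_balanced T)) (100 * (D + 1)\<^sup>2)"
    using Cons.prems by (intro add_computes) auto
  note this[THEN wp_computes]
  moreover have "total_balanced (e # T) =
      (if balanced (fst e) then snd e + total_balanced T else total_balanced T)"
    by (simp add: total_balanced_def split: prod.split)
  ultimately show ?case
    by (simp add: computes_def total_tm_def)
qed

section \<open>Products of tables: invariants and cost\<close>

lemma snd_le_total: "e \<in> set T \<Longrightarrow> snd e \<le> total T"
  by (induction T) auto

lemma finite_keys_length:
  assumes "distinct (map fst T)" "fst ` set T \<subseteq> S" "finite S"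
  shows "length T \<le> card S"
  using card_mono[OF assms(3,2)] distinct_card[OF assms(1)] by simp

text \<open>Distinct keys inside \<open>S\<close> will bound the length of the accumulator once
  \<open>S\<close> is finite, and the exact value of \<open>total\<close> its
  multiplicities.\<close>

lemma row_props:
  assumes "distinct (map fst acc)" "fst ` set acc \<subseteq> S" "\<forall>e'\<in>set T. merge (fst e) (fst e') \<in> S"
  shows "distinct (map fst (row e T acc)) \<and> fst ` set (row e T acc) \<subseteq> S \<and>
    total (row e T acc) = total acc + snd e * total T"
  using assms
proof (induction T arbitrary: acc)
  case (Cons e' T)
  let ?acc = "insert_entry (merge (fst e) (fst e')) (snd e * snd e') acc"
  have "distinct (map fst ?acc)" "fst ` set ?acc \<subseteq> S" "\<forall>e'\<in>set T. merge (fst e) (fst e') \<in> S"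
    using Cons.prems by (simp_all add: distinct_insert_entry)
  from Cons.IH[OF this] show ?case by (simp add: algebra_simps)
qed simp

lemma product_props:
  assumes "distinct (map fst acc)" "fst ` set acc \<subseteq> S"
    "\<forall>e\<in>set T'. \<forall>e'\<in>set T. merge (fst e) (fst e') \<in> S"
  shows "distinct (map fst (product_table T' T acc)) \<and> fst ` set (product_table T' T acc) \<subseteq> S \<and>
    total (product_table T' T acc) = total acc + total T' * total T"
  using assms
proof (induction T' arbitrary: acc)
  case (Cons e T')
  have "distinct (map fst (row e T acc)) \<and> fst ` set (row e T acc) \<subseteq> S \<and>
    total (row e T acc) = total acc + snd e * total T"
    using Cons.prems by (intro row_props) auto
  with Cons.IH[of "row e T acc"] Cons.prems show ?case by (simp add: algebra_simps)
qed simp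

text \<open>\<open>states k D D\<close> bounds the size of a state, its subset \<open>S\<close> the
  number of keys. The last hypothesis is about the final value of \<open>total\<close>, which stays
  the same along the loop; so every intermediate sum fits in \<open>D\<close> bits.\<close>

lemma row_computes:
  assumes D: "1 \<le> D" "k \<le> D"
    and S: "finite S" "card S \<le> D" "S \<subseteq> states k D D"
    and e: "fst e \<in> states k D D" "snd e < 2 ^ D"
    and "fst ` set T \<subseteq> states k D D" "total T < 2 ^ D"
      "\<forall>e'\<in>set T. merge (fst e) (fst e') \<in> S"
      "distinct (map fst acc)" "fst ` set acc \<subseteq> S" "total acc + snd e * total T < 2 ^ D"
  shows "computes (prog m) ROW [enc_entry e, enc_table T, enc_table acc] (enc_table (row e T acc))
    (length T * (5000 * D ^ 3) + 10)"
  using assms(8-)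
proof (induction T arbitrary: acc)
  case Nil
  show ?case by (simp add: computes_def row_tm_def)
next
  case (Cons e' T)
  let ?s = "merge (fst e) (fst e')" and ?c = "snd e * snd e'"
  let ?acc = "insert_entry ?s ?c acc"
  have D3: "1 \<le> D ^ 3" "D \<le> D ^ 3" "D\<^sup>2 \<le> D ^ 3"
    using D power_increasing[of 1 3 D] power_increasing[of 2 3 D] by auto
  have "computes (prog m) MERGE [enc_state (fst e), enc_state (fst e')] (enc_state ?s)
      (length (fst e) * (30 * D + 80) + 10)"
    using e Cons.prems by (intro merge_computes) (auto simp: states_def)
  moreover have "length (fst e) * (30 * D + 80) + 10 \<le> 120 * D ^ 3"
  proof -
    have "length (fst e) * (30 * D + 80) \<le> D * (30 * D + 80)"
      using e D by (auto simp: states_def)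
    also have "\<dots> = 30 * D\<^sup>2 + 80 * D" by (simp add: power2_eq_square distrib_left)
    finally show ?thesis using D3 by linarith
  qed
  ultimately have "computes (prog m) MERGE [enc_state (fst e), enc_state (fst e')] (enc_state ?s)
      (120 * D ^ 3)" by (rule computes_mono)
  note merge = wp_computes[OF this]
  have "computes (prog m) MUL [enc_nat (snd e), enc_nat (snd e')] (enc_nat ?c)
      ((D + 1) * (100 * (2 * D + 1)\<^sup>2 + 60))"
    using e Cons.prems by (intro mul_computes[where B = D]) auto
  \<comment> \<open>The factors have \<open>D\<close> bits each, hence the \<open>2 * D\<close> for
    the product; \<open>3 * D\<close> then replaces \<open>2 * D + 1\<close>, and
    \<open>960 = 9 * 100 + 60\<close>.\<close>
  moreover have "(D + 1) * (100 * (2 * D + 1)\<^sup>2 + 60) \<le> 2000 * D ^ 3"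
  proof -
    have "(2 * D + 1)\<^sup>2 \<le> (3 * D)\<^sup>2" using D by (intro power_mono) auto
    moreover have "1 \<le> D\<^sup>2" using D by simp
    ultimately have "100 * (2 * D + 1)\<^sup>2 + 60 \<le> 960 * D\<^sup>2"
      unfolding power_mult_distrib[of 3] by simp
    then have "(D + 1) * (100 * (2 * D + 1)\<^sup>2 + 60) \<le> (2 * D) * (960 * D\<^sup>2)"
      using D by (intro mult_mono) auto
    then show ?thesis by (simp add: power2_eq_square power3_eq_cube)
  qed
  ultimately have "computes (prog m) MUL [enc_nat (snd e), enc_nat (snd e')] (enc_nat ?c)
      (2000 * D ^ 3)" by (rule computes_mono)
  note mul = wp_computes[OF this]
  have len: "length acc \<le> D"
    using finite_keys_length[OF Cons.prems(4,5) S(1)] S(2) by simp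
  have small: "?c + total acc < 2 ^ D"
    using Cons.prems by (simp add: algebra_simps)
  then have "\<forall>e\<in>set acc. snd e < 2 ^ D"
    using snd_le_total[of _ acc] by fastforce
  then have "computes (prog m) INSERT [enc_state ?s, enc_nat ?c, enc_table acc] (enc_table ?acc)
      (length acc * (30 * size (enc_state ?s) + 50) + 100 * (D + 1)\<^sup>2 + 50)"
    using small by (intro insert_computes) auto
  \<comment> \<open>The scan compares up to \<open>D\<close> keys of size at most
    \<open>5 * D ^ 2\<close>, of the same cubic order as the multiplication.\<close>
  moreover have "length acc * (30 * size (enc_state ?s) + 50) + 100 * (D + 1)\<^sup>2 + 50 \<le> 1000 * D ^ 3"
  proof -
    have s: "?s \<in> states k D D" using Cons.prems S by auto
    then have "size (enc_state ?s) \<le> k * (3 * D + 2)"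
      using size_enc_state[of ?s D] by (simp add: states_def)
    also have "\<dots> \<le> D * (5 * D)" using D by (intro mult_mono) auto
    finally have "size (enc_state ?s) \<le> 5 * D\<^sup>2" by (simp add: power2_eq_square)
    moreover have "1 \<le> D\<^sup>2" using D by simp
    ultimately have "30 * size (enc_state ?s) + 50 \<le> 200 * D\<^sup>2" by linarith
    then have "length acc * (30 * size (enc_state ?s) + 50) \<le> D * (200 * D\<^sup>2)"
      using len by (intro mult_mono) auto
    moreover have "(D + 1)\<^sup>2 \<le> (2 * D)\<^sup>2" using D by (intro power_mono) auto
    moreover have "D * (200 * D\<^sup>2) = 200 * D ^ 3" by (simp add: power2_eq_square power3_eq_cube)
    ultimately show ?thesis using D3 unfolding power_mult_distrib by simp
  qed
  ultimately have "computes (prog m) INSERT [enc_state ?s, enc_nat ?c, enc_table acc] (enc_table ?acc)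
      (1000 * D ^ 3)" by (rule computes_mono)
  note insert = wp_computes[OF this]
  have "computes (prog m) ROW [enc_entry e, enc_table T, enc_table ?acc] (enc_table (row e T ?acc))
      (length T * (5000 * D ^ 3) + 10)"
    using Cons.prems by (intro Cons.IH) (auto simp: distinct_insert_entry algebra_simps)
  note row = wp_computes[OF this]
  show ?case
    using D3(1) by (simp add: computes_def row_tm_def merge mul insert row)
qed

text \<open>The length of \<open>T\<close> is a hypothesis of its own: relabelling may have produced
  repeated keys, so counting states does not bound it.\<close>

lemma product_computes:
  assumes D: "1 \<le> D" "k \<le> D"
    and S: "finite S" "card S \<le> D" "S \<subseteq> states k D D"
    and T: "fst ` set T \<subseteq> states k D D" "total T < 2 ^ D" "length T \<le> D"
    and "fst ` set T' \<subseteq> states k D D" "total T' < 2 ^ D"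
      "\<forall>e\<in>set T'. \<forall>e'\<in>set T. merge (fst e) (fst e') \<in> S"
      "distinct (map fst acc)" "fst ` set acc \<subseteq> S" "total acc + total T' * total T < 2 ^ D"
  shows "computes (prog m) PRODUCT [enc_table T', enc_table T, enc_table acc]
    (enc_table (product_table T' T acc)) (length T' * (6000 * D ^ 4) + 10)"
  using assms(9-)
proof (induction T' arbitrary: acc)
  case Nil
  show ?case by (simp add: computes_def product_tm_def)
next
  case (Cons e T')
  have D4: "1 \<le> D ^ 4" "D * D ^ 3 = D ^ 4"
    using D by (simp_all add: power_numeral_reduce)
  have "computes (prog m) ROW [enc_entry e, enc_table T, enc_table acc]
      (enc_table (row e T acc)) (length T * (5000 * D ^ 3) + 10)"
    using Cons.prems by (intro row_computes[OF D S _ _ T(1,2)]) (auto simp: algebra_simps)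
  moreover have "length T * D ^ 3 \<le> D ^ 4"
    using mult_right_mono[OF T(3), of "D ^ 3"] D4(2) by simp
  ultimately have "computes (prog m) ROW [enc_entry e, enc_table T, enc_table acc]
      (enc_table (row e T acc)) (5000 * D ^ 4 + 10)"
    by (elim computes_mono) simp
  note row = wp_computes[OF this]
  have "distinct (map fst (row e T acc)) \<and> fst ` set (row e T acc) \<subseteq> S \<and>
    total (row e T acc) = total acc + snd e * total T"
    using Cons.prems by (intro row_props) auto
  then have "computes (prog m) PRODUCT [enc_table T', enc_table T, enc_table (row e T acc)]
    (enc_table (product_table T' T (row e T acc))) (length T' * (6000 * D ^ 4) + 10)"
    using Cons.prems by (intro Cons.IH) (auto simp: algebra_simps)
  note product = wp_computes[OF this]
  show ?case
    using D4(1) by (simp add: computes_def product_tm_def row product)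
qed

section \<open>The dynamic program and the size of its tables\<close>

fun leaves :: "cw_expr \<Rightarrow> nat" where
  "leaves (Introduce i) = 1"
| "leaves (Disjoint_Union s t) = leaves s + leaves t"
| "leaves (Relabel i j t) = leaves t"
| "leaves (Join i j t) = leaves t"

fun labels_below :: "nat \<Rightarrow> cw_expr \<Rightarrow> bool" where
  "labels_below w (Introduce i) \<longleftrightarrow> i \<le> w"
| "labels_below w (Disjoint_Union s t) \<longleftrightarrow> labels_below w s \<and> labels_below w t"
| "labels_below w (Relabel i j t) \<longleftrightarrow> i \<le> w \<and> j \<le> w \<and> labels_below w t"
| "labels_below w (Join i j t) \<longleftrightarrow> i \<le> w \<and> j \<le> w \<and> labels_below w t"

fun solve :: "nat \<Rightarrow> cw_expr \<Rightarrow> table" where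
  "solve k (Introduce i) = intro_table (single_bit i, 1) k"
| "solve k (Disjoint_Union s t) = product_table (solve k s) (solve k t) []"
| "solve k (Relabel i j t) = relabel_table i j (solve k t)"
| "solve k (Join i j t) = join_table i j (solve k t)"

text \<open>There are fewer than \<open>2 ^ (w + 2)\<close> vectors of length at most
  \<open>w + 1\<close> (positions \<open>0\<close> to \<open>w\<close>), \<open>n + 1\<close>
  cardinalities \<open>0\<close> to \<open>n\<close>, and \<open>k\<close> independent
  items.\<close>

definition table_bound :: "nat \<Rightarrow> nat \<Rightarrow> nat \<Rightarrow> nat" where
  "table_bound k w n = (2 ^ (w + 2) * (n + 1)) ^ k"

lemma states_card:
  "finite (states k (w + 1) n)" "card (states k (w + 1) n) \<le> table_bound k w n"
proof -
  let ?B = "{b :: bool list. set b \<subseteq> UNIV \<and> length b \<le> w + 1}"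
  have geometric: "(\<Sum>i\<le>m. 2 ^ i) \<le> (2 ^ Suc m :: nat)" for m
    by (induction m) auto
  have B: "finite ?B" "card ?B \<le> 2 ^ (w + 2)"
    using finite_lists_length_le[of "UNIV :: bool set" "w + 1"]
      card_lists_length_le[of "UNIV :: bool set" "w + 1"] geometric[of "w + 1"] by simp_all
  have s: "states k (w + 1) n = {s. set s \<subseteq> ?B \<times> {..n} \<and> length s = k}"
    by (auto simp: states_def)
  have fin: "finite (?B \<times> {..n})" using B by blast
  show "finite (states k (w + 1) n)"
    unfolding s by (rule finite_lists_length_eq[OF fin])
  have "card (states k (w + 1) n) = (card ?B * (n + 1)) ^ k"
    unfolding s card_lists_length_eq[OF fin] card_cartesian_product by simp
  also have "\<dots> \<le> table_bound k w n"
    unfolding table_bound_def using B by (intro power_mono mult_right_mono) auto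
  finally show "card (states k (w + 1) n) \<le> table_bound k w n" .
qed

lemma table_bound_mono: "n \<le> n' \<Longrightarrow> table_bound k w n \<le> table_bound k w n'"
  unfolding table_bound_def by (intro power_mono mult_left_mono) auto

text \<open>One quantity dominates all parameters, so every cost becomes a power of it. The bound on
  \<open>k * n + 1\<close> serves the multiplicities, which are at most
  \<open>k ^ n\<close>.\<close>

lemma table_bound_ge:
  assumes "1 \<le> k"
  shows "1 \<le> table_bound k w n" "k \<le> table_bound k w n" "w + 1 \<le> table_bound k w n"
    "n \<le> table_bound k w n" "k * n + 1 \<le> table_bound k w n"
proof -
  have *: "a ^ k * b ^ k \<le> table_bound k w n" if "a \<le> 2 ^ (w + 2)" "b \<le> n + 1" for a b
    unfolding table_bound_def power_mult_distrib[symmetric]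
    using that by (intro power_mono mult_mono) auto
  have k: "k < 2 ^ k" by simp
  have two: "2 \<le> (2 :: nat) ^ (w + 2)" by simp
  have self: "x \<le> x ^ k" for x :: nat
    using assms by (cases x) (auto intro: self_le_power)
  show "k \<le> table_bound k w n" using order_trans[OF less_imp_le[OF k]] *[OF two, of 1] by simp
  then show "1 \<le> table_bound k w n" using assms by simp
  have "w + 1 \<le> 2 ^ (w + 2)" by (induction w) auto
  from *[OF this, of 1] self[of "w + 1"] show "w + 1 \<le> table_bound k w n" by simp
  show "n \<le> table_bound k w n" using *[of 1 n] self[of n] by simp
  have "k * n + 1 \<le> 2 ^ k * n + 2 ^ k" using k by (intro add_mono mult_right_mono) auto
  also have "\<dots> = 2 ^ k * (n + 1)" by simp
  also have "\<dots> \<le> 2 ^ k * (n + 1) ^ k" by (intro mult_left_mono self) simp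
  also have "\<dots> \<le> table_bound k w n" using *[OF two] by simp
  finally show "k * n + 1 \<le> table_bound k w n" .
qed

lemma merge_states:
  assumes "s \<in> states k L N" "s' \<in> states k L N'"
  shows "merge s s' \<in> states k L (N + N')"
proof -
  have "length (fst x) \<le> L \<and> snd x \<le> N + N'" if x: "x \<in> set (merge s s')" for x
  proof -
    obtain y z where yz: "(y, z) \<in> set (zip s s')" "x = merge_item y z"
      using x by (auto simp: merge_def)
    then have "y \<in> set s" "z \<in> set s'"
      by (auto dest: set_zip_leftD set_zip_rightD)
    with assms have "length (fst y) \<le> L \<and> snd y \<le> N" "length (fst z) \<le> L \<and> snd z \<le> N'"
      by (auto simp: states_def simp del: split_paired_All)
    then show ?thesis by (simp add: yz merge_item_def)
  qed
  with assms show ?thesis by (auto simp: states_def merge_def)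
qed

text \<open>Distinctness of keys is not part of the invariant, since relabelling can destroy it. A
  disjoint union restores it, and the length is bounded afresh by the number of available
  keys.\<close>

lemma solve_props:
  assumes "labels_below w t" "1 \<le> k"
  shows "fst ` set (solve k t) \<subseteq> states k (w + 1) (leaves t)"
    and "length (solve k t) \<le> table_bound k w (leaves t)"
    and "total (solve k t) \<le> k ^ leaves t"
proof -
  have "fst ` set (solve k t) \<subseteq> states k (w + 1) (leaves t) \<and>
     length (solve k t) \<le> table_bound k w (leaves t) \<and> total (solve k t) \<le> k ^ leaves t"
    using assms(1)
  proof (induction t)
    case (Introduce i)
    have x: "\<forall>e\<in>set (intro_table x j). fst e \<in> states j L 1"
      if "length (fst x) \<le> L" "snd x \<le> 1" for x L j
      using that by (induction j) (fastforce simp: states_def)+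
    have "fst ` set (intro_table (single_bit i, 1) k) \<subseteq> states k (w + 1) 1"
      using x[of "(single_bit i, 1)" "w + 1" k] Introduce unfolding image_subset_iff by simp
    moreover have "total (intro_table x j) = j" for x j
      by (induction j) (simp_all add: total_def comp_def)
    ultimately show ?case
      using table_bound_ge(2)[OF assms(2), of w 1] by simp
  next
    case (Disjoint_Union s t)
    let ?S = "states k (w + 1) (leaves s + leaves t)"
    have p: "distinct (map fst (product_table (solve k s) (solve k t) [])) \<and>
      fst ` set (product_table (solve k s) (solve k t) []) \<subseteq> ?S \<and>
      total (product_table (solve k s) (solve k t) []) =
        total ([] :: table) + total (solve k s) * total (solve k t)"
      using Disjoint_Union by (intro product_props) (auto intro!: merge_states)
    \<comment> \<open>The product of the two lengths would be too weak a bound: it compounds along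
      nested unions.\<close>
    then have "length (product_table (solve k s) (solve k t) []) \<le> card ?S"
      using states_card by (intro finite_keys_length) auto
    then show ?case
      using p Disjoint_Union states_card(2)[of k w "leaves s + leaves t"]
      by (auto simp: power_add mult_mono)
  next
    case (Relabel i j t)
    have "map (relabel_item i j) s \<in> states k (w + 1) N" if "s \<in> states k (w + 1) N" for s N
      using that Relabel.prems by (auto simp: states_def relabel_item_def)
    moreover have "total (relabel_table i j T) = total T" for T
      by (simp add: total_def relabel_table_def comp_def)
    ultimately show ?case
      using Relabel by (auto simp: relabel_table_def)
  next
    case (Join i j t)
    have "total (join_table i j T) \<le> total T" for T
      by (induction T) (auto simp: join_table_def)
    then have "total (join_table i j (solve k t)) \<le> k ^ leaves t"
      using Join order_trans by auto
    moreover have "length (join_table i j (solve k t)) \<le> table_bound k w (leaves t)"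
      unfolding join_table_def by (rule order_trans[OF length_filter_le]) (use Join in simp)
    ultimately show ?case
      using Join by (auto simp: join_table_def)
  qed
  then show "fst ` set (solve k t) \<subseteq> states k (w + 1) (leaves t)"
    and "length (solve k t) \<le> table_bound k w (leaves t)"
    and "total (solve k t) \<le> k ^ leaves t" by auto
qed

text \<open>By \<open>k \<le> 2 ^ k\<close>, the power \<open>k ^ l\<close> has at most
  \<open>k * n + 1\<close> bits, so numbers of \<open>table_bound k w n\<close> bits hold every
  multiplicity.\<close>

lemma power_less_table_bound:
  assumes "1 \<le> k" "l \<le> n"
  shows "k ^ l < 2 ^ table_bound k w n"
proof -
  have "k ^ l \<le> (2 ^ k) ^ l" by (intro power_mono) (auto intro: less_imp_le)
  also have "\<dots> = 2 ^ (k * l)" by (simp add: power_mult)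
  also have "\<dots> < 2 ^ (k * n + 1)"
    using assms by (intro power_strict_increasing) (simp_all add: le_imp_less_Suc)
  also have "\<dots> \<le> 2 ^ table_bound k w n"
    using table_bound_ge(5)[OF assms(1)] by (intro power_increasing) auto
  finally show ?thesis .
qed

section \<open>Running time of the evaluation of an expression\<close>

lemma enc_nat_numerals:
  "enc_nat 1 = Cell (Cell Nul Nul) Nul"
  "enc_nat (Suc 0) = Cell (Cell Nul Nul) Nul"
  "enc_nat 2 = Cell Nul (Cell (Cell Nul Nul) Nul)"
  "enc_nat 3 = Cell (Cell Nul Nul) (Cell (Cell Nul Nul) Nul)"
  by (simp_all add: enc_nat_pos)

lemma num_ops_pos [simp]: "0 < num_ops t"
  by (induction t) auto

lemma unary_bounded:
  assumes "i \<le> D" "1 \<le> D"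
  shows "computes (prog m) UNARY [enc_nat i] (enc_unary i) (210 * D\<^sup>2)"
proof (rule computes_mono[OF unary_computes])
  have "i\<^sup>2 \<le> D\<^sup>2" "1 \<le> D\<^sup>2" using assms by (auto intro: power_mono)
  then show "200 * i\<^sup>2 + 10 \<le> 210 * D\<^sup>2" by linarith
qed

text \<open>Disjoint union dominates, with up to \<open>D\<close> rows of cost about
  \<open>D ^ 4\<close>; every operation is granted that much.\<close>

lemma solve_computes:
  assumes "labels_below w t" "1 \<le> k" "leaves t \<le> n"
  defines "D \<equiv> table_bound k w n"
  shows "computes (prog m) SOLVE [enc_unary k, enc_cw_expr t] (enc_table (solve k t))
    (num_ops t * (10000 * D ^ 5))"
  using assms(1,3)
proof (induction t)
  note D = table_bound_ge[OF assms(2), where w = w and n = n, folded D_def]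
  have D5: "1 \<le> D ^ 5" "D \<le> D ^ 5" "D\<^sup>2 \<le> D ^ 5" "D ^ 3 \<le> D ^ 5" "D * D ^ 4 = D ^ 5"
    using D(1) power_increasing[of 1 5 D] by (simp_all add: power_increasing power_numeral_reduce)
  have table: "fst ` set (solve k t) \<subseteq> states k D D" "length (solve k t) \<le> D"
      "total (solve k t) < 2 ^ D" "\<forall>e\<in>set (solve k t). length (fst e) = k"
    if "labels_below w t" "leaves t \<le> n" for t
  proof -
    note props = solve_props[OF that(1) assms(2)]
    show sub: "fst ` set (solve k t) \<subseteq> states k D D"
      by (rule subset_trans[OF props(1) states_mono]) (use D that(2) in auto)
    show "length (solve k t) \<le> D"
      using props(2) table_bound_mono[OF that(2), of k w] unfolding D_def by linarith
    show "total (solve k t) < 2 ^ D"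
      using props(3) power_less_table_bound[OF assms(2) that(2), of w] unfolding D_def by linarith
    show "\<forall>e\<in>set (solve k t). length (fst e) = k"
      using sub by (auto simp: states_def)
  qed
  \<comment> \<open>The block lets the facts above survive each \<open>next\<close>.\<close>
  {
    case (Introduce i)
    then have i: "i \<le> D" using D by simp
    have "computes (prog m) SINGLE [enc_unary i] (enc_bits (single_bit i)) (30 * D)"
      by (rule computes_mono[OF single_computes]) (use i D in simp)
    note single = wp_computes[OF this]
    have "k * (40 * k + 60) + 10 \<le> D * (40 * D + 60) + 10"
      using D by (intro add_mono mult_mono) auto
    also have "\<dots> \<le> 40 * D\<^sup>2 + 70 * D" using D by (simp add: power2_eq_square distrib_left)
    finally have "computes (prog m) INTRO [Cell (enc_bits (single_bit i)) (Cell Nul Nul), enc_unary k]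
        (enc_table (intro_table (single_bit i, Suc 0) k)) (40 * D\<^sup>2 + 70 * D)"
      using computes_mono[OF intro_computes[of m "(single_bit i, 1)"]] by (simp add: enc_item_def)
    note intro = wp_computes[OF this]
    show ?case
      using D5 by (simp add: computes_def solve_tm_def intro single
          wp_computes[OF unary_bounded[OF i D(1)]])
  next
    case (Disjoint_Union s t)
    then have s: "labels_below w s" "leaves s \<le> n" and t: "labels_below w t" "leaves t \<le> n"
      by auto
    note IH = wp_computes[OF Disjoint_Union.IH(1)[OF s]] wp_computes[OF Disjoint_Union.IH(2)[OF t]]
    \<comment> \<open>\<open>merge\<close> adds cardinalities, so the keys stay within the number of
      vertices of both parts.\<close>
    let ?S = "states k (w + 1) (leaves s + leaves t)"
    have st: "leaves s + leaves t \<le> n" using Disjoint_Union.prems by simp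
    have "card ?S \<le> D"
      using states_card(2)[of k w "leaves s + leaves t"] table_bound_mono[OF st, of k w]
      unfolding D_def by linarith
    moreover have "?S \<subseteq> states k D D"
      using D st by (intro states_mono) auto
    moreover have "\<forall>e\<in>set (solve k s). \<forall>e'\<in>set (solve k t). merge (fst e) (fst e') \<in> ?S"
      using solve_props(1)[OF s(1) assms(2)] solve_props(1)[OF t(1) assms(2)]
      by (auto intro!: merge_states)
    moreover have "total (solve k s) * total (solve k t) < 2 ^ D"
    proof -
      have "total (solve k s) * total (solve k t) \<le> k ^ (leaves s + leaves t)"
        unfolding power_add
        using solve_props(3)[OF s(1) assms(2)] solve_props(3)[OF t(1) assms(2)]
        by (intro mult_mono) auto
      also have "\<dots> < 2 ^ D"
        unfolding D_def by (rule power_less_table_bound[OF assms(2) st])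
      finally show ?thesis .
    qed
    ultimately have "computes (prog m) PRODUCT [enc_table (solve k s), enc_table (solve k t), enc_table []]
      (enc_table (product_table (solve k s) (solve k t) []))
      (length (solve k s) * (6000 * D ^ 4) + 10)"
      using table[OF s] table[OF t] D
      by (intro product_computes[where S = ?S]) (simp_all add: states_card(1)[simplified])
    moreover have "length (solve k s) * (6000 * D ^ 4) + 10 \<le> 6000 * D ^ 5 + 10"
      using mult_right_mono[OF table(2)[OF s], of "D ^ 4"] D5(5) by simp
    ultimately have "computes (prog m) PRODUCT [enc_table (solve k s), enc_table (solve k t), Nul]
      (enc_table (product_table (solve k s) (solve k t) [])) (6000 * D ^ 5 + 10)"
      using computes_mono by simp
    note product = wp_computes[OF this]
    show ?case
      using D5(1)
      by (simp add: computes_def solve_tm_def IH product enc_nat_numerals add_mult_distrib)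
  next
    case (Relabel i j t)
    then have t: "labels_below w t" "leaves t \<le> n" and ij: "i \<le> D" "j \<le> D"
      using D by auto
    have "length (solve k t) * (k * (100 * (i + j + 1) + 20) + 60) + 10
        \<le> D * (D * (100 * (3 * D) + 20 * D) + 60 * (D * D)) + 10"
      using table(2)[OF t] ij D by (intro add_mono mult_mono) auto
    also have "\<dots> = 380 * D ^ 3 + 10"
      by (simp add: power3_eq_cube algebra_simps)
    finally have "computes (prog m) RELABEL_TABLE [enc_unary i, enc_unary j, enc_table (solve k t)]
        (enc_table (relabel_table i j (solve k t))) (380 * D ^ 3 + 10)"
      by (rule computes_mono[OF relabel_table_computes[OF table(4)[OF t]]])
    note relabel = wp_computes[OF this]
    show ?case
      using D5 by (simp add: computes_def solve_tm_def relabel enc_nat_numerals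
          wp_computes[OF Relabel.IH[OF t]]
          wp_computes[OF unary_bounded[OF ij(1) D(1)]] wp_computes[OF unary_bounded[OF ij(2) D(1)]])
  next
    case (Join i j t)
    then have t: "labels_below w t" "leaves t \<le> n" and ij: "i \<le> D" "j \<le> D"
      using D by auto
    have "length (solve k t) * (k * (10 * (i + j) + 60) + 60) + 10
        \<le> D * (D * (10 * (2 * D) + 60 * D) + 60 * (D * D)) + 10"
      using table(2)[OF t] ij D by (intro add_mono mult_mono) auto
    also have "\<dots> = 140 * D ^ 3 + 10"
      by (simp add: power3_eq_cube algebra_simps)
    finally have "computes (prog m) JOIN_TABLE [enc_unary i, enc_unary j, enc_table (solve k t)]
        (enc_table (join_table i j (solve k t))) (140 * D ^ 3 + 10)"
      by (rule computes_mono[OF join_table_computes[OF table(4)[OF t]]])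
    note join = wp_computes[OF this]
    show ?case
      using D5 by (simp add: computes_def solve_tm_def join enc_nat_numerals
          wp_computes[OF Join.IH[OF t]]
          wp_computes[OF unary_bounded[OF ij(1) D(1)]] wp_computes[OF unary_bounded[OF ij(2) D(1)]])
  }
qed

text \<open>\<open>g\<close> is arbitrary because the expression already determines the graph.
  Doubling the constant of \<open>SOLVE\<close> pays for converting \<open>k\<close> and for the
  final sum, as there is at least one operation.\<close>

lemma start_computes:
  assumes "labels_below w t" "1 \<le> k" "leaves t \<le> n"
  defines "D \<equiv> table_bound k w n"
  shows "computes (prog m) START [enc_nat k, Cell g (enc_cw_expr t)]
    (enc_nat (total_balanced (solve k t))) (num_ops t * (20000 * D ^ 5))"
proof -
  note D = table_bound_ge[OF assms(2), where w = w and n = n, folded D_def]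
  have D5: "1 \<le> D ^ 5" "D\<^sup>2 \<le> D ^ 5" "D ^ 4 \<le> D ^ 5"
    using D(1) by (simp_all add: power_increasing)
  note props = solve_props[OF assms(1,2)]
  have "fst ` set (solve k t) \<subseteq> states k D D"
    by (rule subset_trans[OF props(1) states_mono]) (use D assms(3) in auto)
  then have "\<forall>e\<in>set (solve k t). fst e \<in> states k D D" by auto
  moreover have "total (solve k t) < 2 ^ D"
    using props(3) power_less_table_bound[OF assms(2,3), of w] unfolding D_def by linarith
  moreover have "length (solve k t) * (k * (k * (20 * D + 50) + 50) + 100 * (D + 1)\<^sup>2 + 60) + 10
    \<le> D * (D * (D * (20 * D + 50 * D) + 50 * (D * D)) + 100 * (D * (2 * D)\<^sup>2) + 60 * (D * (D * D))) + 10"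
  proof (intro add_mono mult_mono)
    show "length (solve k t) \<le> D"
      using props(2) table_bound_mono[OF assms(3), of k w] unfolding D_def by linarith
    show "(D + 1)\<^sup>2 \<le> D * (2 * D)\<^sup>2"
      using power_mono[of "D + 1" "2 * D" 2] D(1) mult_right_mono[of 1 D "(2 * D)\<^sup>2"] by linarith
  qed (use D in auto)
  then have "length (solve k t) * (k * (k * (20 * D + 50) + 50) + 100 * (D + 1)\<^sup>2 + 60) + 10
    \<le> 580 * D ^ 4 + 10"
    by (simp add: power4_eq_xxxx power2_eq_square algebra_simps)
  ultimately have "computes (prog m) TOTAL [enc_table (solve k t)]
      (enc_nat (total_balanced (solve k t))) (580 * D ^ 4 + 10)"
    by (blast intro: computes_mono total_computes)
  note total = wp_computes[OF this]
  note solve = wp_computes[OF solve_computes[OF assms(1-3), folded D_def]]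
  have "D ^ 5 \<le> num_ops t * D ^ 5" by (simp add: Suc_le_eq)
  then have "num_ops t * (10000 * D ^ 5) + 210 * D\<^sup>2 + 580 * D ^ 4 + 100 \<le> num_ops t * (20000 * D ^ 5)"
    using D5 by linarith
  then show ?thesis
    by (simp add: computes_def start_tm_def total solve wp_computes[OF unary_bounded[OF D(2,1)]])
qed

section \<open>Tables as measures on abstract states\<close>

section \<open>Correctness of the dynamic program\<close>

text \<open>Passing from vectors to sets forgets trailing zeros, the only ambiguity of the
  representation.\<close>

definition abstract_state :: "item list \<Rightarrow> (nat set \<times> nat) list" where
  "abstract_state s = map (\<lambda>x. ({i. bit_at (fst x) i}, snd x)) s"

text \<open>The integral of \<open>f\<close> against the table as a measure; entries with the same
  abstract state add up by themselves.\<close>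

definition weight :: "((nat set \<times> nat) list \<Rightarrow> nat) \<Rightarrow> table \<Rightarrow> nat" where
  "weight f T = (\<Sum>(s, c)\<leftarrow>T. c * f (abstract_state s))"

definition profile :: "nat \<Rightarrow> 'a set \<Rightarrow> ('a \<Rightarrow> nat) \<Rightarrow> ('a \<Rightarrow> nat) \<Rightarrow> (nat set \<times> nat) list" where
  "profile k V lab \<phi> =
     map (\<lambda>c. (lab ` {v \<in> V. \<phi> v = c}, card {v \<in> V. \<phi> v = c})) [1..<Suc k]"

definition combine where
  "combine p q = map2 (\<lambda>x y. (fst x \<union> fst y, snd x + snd y)) p q"

lemma weight_simps [simp]:
  "weight f [] = 0"
  "weight f (e # T) = snd e * f (abstract_state (fst e)) + weight f T"
  by (simp_all add: weight_def split: prod.split)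

lemma abstract_merge:
  "abstract_state (merge s s') = combine (abstract_state s) (abstract_state s')"
  unfolding abstract_state_def merge_def combine_def
  by (simp add: zip_map1 zip_map2 comp_def case_prod_unfold merge_item_def) auto

lemma weight_insert_entry:
  "weight f (insert_entry s c T) = c * f (abstract_state s) + weight f T"
  by (induction T) (auto simp: algebra_simps)

lemma weight_row:
  "weight f (row e T acc) =
     weight f acc + snd e * weight (\<lambda>q. f (combine (abstract_state (fst e)) q)) T"
  by (induction T arbitrary: acc) (auto simp: weight_insert_entry abstract_merge algebra_simps)

text \<open>A product table is the convolution of its factors under \<open>combine\<close>; the
  iterated \<open>weight\<close> mirrors a double sum over pairs of colorings.\<close>

lemma weight_product:
  "weight f (product_table T' T acc) =
     weight f acc + weight (\<lambda>p. weight (\<lambda>q. f (combine p q)) T) T'"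
  by (induction T' arbitrary: acc) (auto simp: weight_row algebra_simps)

text \<open>Relabelling pushes the measure forward, so it is absorbed into the integrand; a join
  likewise multiplies the integrand by an indicator.\<close>

lemma weight_relabel:
  "weight f (relabel_table i j T) =
     weight (\<lambda>p. f (map (apfst (\<lambda>L. if i \<in> L then insert j (L - {i}) else L)) p)) T"
proof -
  have "abstract_state (map (relabel_item i j) s) =
      map (apfst (\<lambda>L. if i \<in> L then insert j (L - {i}) else L)) (abstract_state s)" for s
    by (auto simp: abstract_state_def relabel_item_def)
  then show ?thesis
    by (induction T) (auto simp: relabel_table_def)
qed

lemma weight_join:
  "weight f (join_table i j T) =
     weight (\<lambda>p. if \<exists>x\<in>set p. i \<in> fst x \<and> j \<in> fst x then 0 else f p) T"
proof -
  have "(\<exists>x\<in>set (abstract_state s). i \<in> fst x \<and> j \<in> fst x) \<longleftrightarrow> clash i j s" for s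
    by (auto simp: abstract_state_def clash_def)
  then show ?thesis
    by (induction T) (auto simp: join_table_def)
qed

lemma intro_table_eq:
  "intro_table x k = map (\<lambda>c. ((replicate k ([], 0))[c := x], 1)) [0..<k]"
proof (induction k)
  case (Suc k)
  have "[0..<Suc k] = 0 # map Suc [0..<k]"
    by (simp add: map_Suc_upt upt_conv_Cons del: upt_Suc)
  then show ?case by (simp add: Suc del: upt_Suc)
qed simp

lemma builds_props:
  assumes "builds w t V E lab"
  shows "finite V" "card V = leaves t" "labels_below w t" "\<forall>e\<in>E. e \<subseteq> V"
proof -
  have "finite V \<and> card V = leaves t \<and> labels_below w t \<and> (\<forall>e\<in>E. e \<subseteq> V)"
    using assms by induction (auto simp: card_Un_disjoint)
  then show "finite V" "card V = leaves t" "labels_below w t" "\<forall>e\<in>E. e \<subseteq> V" by auto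
qed

lemma finite_colorings: "finite V \<Longrightarrow> finite (colorings k V E)"
  unfolding colorings_def by (rule finite_subset[OF _ finite_PiE[of V "\<lambda>_. {1..k}"]]) auto

text \<open>Every edge lies within one side, so a coloring of the union is a pair of colorings.
  Extensionality makes restriction and gluing mutually inverse.\<close>

lemma sum_colorings_disjoint_union:
  assumes disj: "V \<inter> V' = {}" and edges: "\<forall>e\<in>E. e \<subseteq> V" "\<forall>e\<in>E'. e \<subseteq> V'"
  shows "(\<Sum>\<phi>\<in>colorings k (V \<union> V') (E \<union> E'). F (restrict \<phi> V) (restrict \<phi> V')) =
    (\<Sum>\<phi>\<in>colorings k V E. \<Sum>\<psi>\<in>colorings k V' E'. F \<phi> \<psi>)"
proof -
  let ?join = "\<lambda>(\<phi>, \<psi>) v. if v \<in> V then \<phi> v else \<psi> v"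
  have 1: "u \<in> V \<and> v \<in> V" if "{u, v} \<in> E" for u v using edges that by auto
  \<comment> \<open>An edge of \<open>E'\<close> avoids \<open>V\<close>, so the glued map takes its
    second branch at both ends.\<close>
  have 2: "u \<in> V' \<and> v \<in> V' \<and> u \<notin> V \<and> v \<notin> V" if "{u, v} \<in> E'" for u v
  proof -
    have "{u, v} \<subseteq> V'" using edges(2) that by (rule bspec)
    with disj show ?thesis by auto
  qed
  have "(\<Sum>\<phi>\<in>colorings k (V \<union> V') (E \<union> E'). F (restrict \<phi> V) (restrict \<phi> V')) =
    (\<Sum>(\<phi>, \<psi>)\<in>colorings k V E \<times> colorings k V' E'. F \<phi> \<psi>)"
  proof (rule sum.reindex_bij_witness[where i = ?join and j = "\<lambda>\<phi>. (restrict \<phi> V, restrict \<phi> V')"])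
    fix p assume "p \<in> colorings k V E \<times> colorings k V' E'"
    then obtain \<phi> \<psi> where p: "p = (\<phi>, \<psi>)"
      and \<phi>: "\<phi> \<in> V \<rightarrow>\<^sub>E {1..k}" "\<And>u v. {u, v} \<in> E \<Longrightarrow> \<phi> u \<noteq> \<phi> v"
      and \<psi>: "\<psi> \<in> V' \<rightarrow>\<^sub>E {1..k}" "\<And>u v. {u, v} \<in> E' \<Longrightarrow> \<psi> u \<noteq> \<psi> v"
      by (auto simp: colorings_def)
    have "restrict (?join p) V = \<phi>"
      using \<phi>(1) by (auto simp: p fun_eq_iff PiE_iff extensional_def)
    moreover have "restrict (?join p) V' = \<psi>"
      using \<psi>(1) disj by (auto simp: p fun_eq_iff PiE_iff extensional_def)
    ultimately show "(restrict (?join p) V, restrict (?join p) V') = p" by (simp add: p)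
    have "?join p u \<noteq> ?join p v" if "{u, v} \<in> E \<union> E'" for u v
      using that 1[of u v] 2[of u v] \<phi>(2)[of u v] \<psi>(2)[of u v] by (auto simp: p)
    moreover have "?join p \<in> V \<union> V' \<rightarrow>\<^sub>E {1..k}"
      using \<phi>(1) \<psi>(1) by (auto simp: p PiE_iff extensional_def)
    ultimately show "?join p \<in> colorings k (V \<union> V') (E \<union> E')"
      unfolding colorings_def by blast
  next
    fix \<phi> assume \<phi>: "\<phi> \<in> colorings k (V \<union> V') (E \<union> E')"
    then have P: "\<phi> \<in> V \<union> V' \<rightarrow>\<^sub>E {1..k}" and ne: "\<And>u v. {u, v} \<in> E \<union> E' \<Longrightarrow> \<phi> u \<noteq> \<phi> v"
      by (auto simp: colorings_def)
    show "?join (restrict \<phi> V, restrict \<phi> V') = \<phi>"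
      using P by (auto simp: fun_eq_iff PiE_iff extensional_def)
    have "restrict \<phi> V u \<noteq> restrict \<phi> V v" if "{u, v} \<in> E" for u v
      using that 1[of u v] ne[of u v] by simp
    moreover have "restrict \<phi> V' u \<noteq> restrict \<phi> V' v" if "{u, v} \<in> E'" for u v
      using that 2[of u v] ne[of u v] by simp
    ultimately show "(restrict \<phi> V, restrict \<phi> V') \<in> colorings k V E \<times> colorings k V' E'"
      using P by (simp add: colorings_def PiE_iff)
  qed auto
  then show ?thesis by (simp add: sum.cartesian_product)
qed

lemma profile_disjoint_union:
  assumes "finite V" "finite V'" "V \<inter> V' = {}"
  shows "profile k (V \<union> V') (\<lambda>v. if v \<in> V then lab v else lab' v) \<phi> =
    combine (profile k V lab (restrict \<phi> V)) (profile k V' lab' (restrict \<phi> V'))"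
proof -
  have "{v \<in> V. restrict \<phi> V v = c} = {v \<in> V. \<phi> v = c}" "{v \<in> V'. restrict \<phi> V' v = c} = {v \<in> V'. \<phi> v = c}"
    for c by auto
  moreover have "card {v \<in> V \<union> V'. \<phi> v = c} = card {v \<in> V. \<phi> v = c} + card {v \<in> V'. \<phi> v = c}" for c
  proof -
    have "{v \<in> V \<union> V'. \<phi> v = c} = {v \<in> V. \<phi> v = c} \<union> {v \<in> V'. \<phi> v = c}" by auto
    then show ?thesis using assms by (simp add: card_Un_disjoint disjoint_iff)
  qed
  moreover have "(\<lambda>v. if v \<in> V then lab v else lab' v) ` {v \<in> V \<union> V'. \<phi> v = c} =
      lab ` {v \<in> V. \<phi> v = c} \<union> lab' ` {v \<in> V'. \<phi> v = c}" for c
    using assms(3) by (force simp: image_iff)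
  ultimately show ?thesis
    by (simp add: profile_def combine_def zip_map1 zip_map2 comp_def case_prod_unfold zip_same_conv_map
        del: upt_Suc)
qed

lemma profile_relabel:
  "profile k V (\<lambda>v. if lab v = i then j else lab v) \<phi> =
    map (apfst (\<lambda>L. if i \<in> L then insert j (L - {i}) else L)) (profile k V lab \<phi>)"
  if "i \<noteq> j"
proof -
  have "(\<lambda>v. if lab v = i then j else lab v) ` A =
      (if i \<in> lab ` A then insert j (lab ` A - {i}) else lab ` A)" for A
    using that by (auto simp: image_iff)
  then show ?thesis by (simp add: profile_def del: upt_Suc)
qed

text \<open>A new edge is monochromatic in color \<open>c\<close> exactly when both labels occur in
  class \<open>c\<close>; hence label sets suffice and individual vertices can be forgotten.\<close>

lemma colorings_join:
  "colorings k V (E \<union> {{u, v} | u v. u \<in> V \<and> v \<in> V \<and> lab u = i \<and> lab v = j}) =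
    {\<phi> \<in> colorings k V E. \<not> (\<exists>x\<in>set (profile k V lab \<phi>). i \<in> fst x \<and> j \<in> fst x)}"
proof (rule set_eqI)
  fix \<phi> :: "'a \<Rightarrow> nat"
  let ?J = "{{u, v} | u v. u \<in> V \<and> v \<in> V \<and> lab u = i \<and> lab v = j}"
  let ?clash = "\<exists>u\<in>V. \<exists>v\<in>V. lab u = i \<and> lab v = j \<and> \<phi> u = \<phi> v"
  have proper: "\<phi> u \<noteq> \<phi> v" if no: "\<not> ?clash" and "{u, v} \<in> ?J" for u v
  proof -
    obtain a b where ab: "{u, v} = {a, b}" "a \<in> V" "b \<in> V" "lab a = i" "lab b = j"
      using \<open>{u, v} \<in> ?J\<close> by auto
    with no have "\<phi> a \<noteq> \<phi> b" by blast
    with ab(1) show ?thesis by (auto simp: doubleton_eq_iff)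
  qed
  have new: "(\<forall>u v. {u, v} \<in> ?J \<longrightarrow> \<phi> u \<noteq> \<phi> v) \<longleftrightarrow> \<not> ?clash"
  proof
    assume all: "\<forall>u v. {u, v} \<in> ?J \<longrightarrow> \<phi> u \<noteq> \<phi> v"
    show "\<not> ?clash"
    proof
      assume ?clash
      then obtain u v where uv: "u \<in> V" "v \<in> V" "lab u = i" "lab v = j" "\<phi> u = \<phi> v" by blast
      then have "{u, v} \<in> ?J" by blast
      with all uv(5) show False by simp
    qed
  qed (intro allI impI proper)
  have "(\<exists>x\<in>set (profile k V lab \<phi>). i \<in> fst x \<and> j \<in> fst x) \<longleftrightarrow> ?clash"
    if "\<phi> \<in> V \<rightarrow>\<^sub>E {1..k}"
  proof -
    \<comment> \<open>The profile lists the colors \<open>1\<close> to \<open>k\<close> only, so the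
      common color must be shown to lie in that range.\<close>
    have color: "\<phi> u \<in> {1..k}" if "u \<in> V" for u
      using \<open>\<phi> \<in> V \<rightarrow>\<^sub>E {1..k}\<close> that by auto
    have "(\<exists>x\<in>set (profile k V lab \<phi>). i \<in> fst x \<and> j \<in> fst x) \<longleftrightarrow>
        (\<exists>c\<in>{1..k}. (\<exists>u\<in>V. \<phi> u = c \<and> lab u = i) \<and> (\<exists>v\<in>V. \<phi> v = c \<and> lab v = j))"
      unfolding profile_def set_map set_upt atLeastLessThanSuc_atLeastAtMost by (simp add: image_iff) blast
    also have "\<dots> \<longleftrightarrow> ?clash"
    proof
      assume ?clash
      then obtain u v where "u \<in> V" "v \<in> V" "lab u = i" "lab v = j" "\<phi> u = \<phi> v" by blast
      then show "\<exists>c\<in>{1..k}. (\<exists>u\<in>V. \<phi> u = c \<and> lab u = i) \<and> (\<exists>v\<in>V. \<phi> v = c \<and> lab v = j)"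
        using color[of u] by (intro bexI[of _ "\<phi> u"]) auto
    next
      assume "\<exists>c\<in>{1..k}. (\<exists>u\<in>V. \<phi> u = c \<and> lab u = i) \<and> (\<exists>v\<in>V. \<phi> v = c \<and> lab v = j)"
      then obtain u v where "u \<in> V" "v \<in> V" "lab u = i" "lab v = j" "\<phi> u = \<phi> v" by auto
      then show ?clash by blast
    qed
    finally show ?thesis .
  qed
  note clash = this
  have Un: "(\<forall>u v. {u, v} \<in> X \<union> Y \<longrightarrow> \<phi> u \<noteq> \<phi> v) \<longleftrightarrow>
      (\<forall>u v. {u, v} \<in> X \<longrightarrow> \<phi> u \<noteq> \<phi> v) \<and> (\<forall>u v. {u, v} \<in> Y \<longrightarrow> \<phi> u \<noteq> \<phi> v)" for X Y
    by auto
  show "\<phi> \<in> colorings k V (E \<union> ?J) \<longleftrightarrow>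
      \<phi> \<in> {\<phi> \<in> colorings k V E. \<not> (\<exists>x\<in>set (profile k V lab \<phi>). i \<in> fst x \<and> j \<in> fst x)}"
  proof (cases "\<phi> \<in> V \<rightarrow>\<^sub>E {1..k}")
    case True
    show ?thesis
      unfolding colorings_def mem_Collect_eq Un new[unfolded mem_Collect_eq] clash[OF True] by (rule conj_assoc[symmetric])
  qed (simp add: colorings_def)
qed

text \<open>\<open>f\<close> is arbitrary in the induction, since most operations hand a changed
  integrand to the induction hypothesis.\<close>

lemma weight_solve:
  assumes "builds w t V E lab"
  shows "weight f (solve k t) = (\<Sum>\<phi>\<in>colorings k V E. f (profile k V lab \<phi>))"
  using assms
proof (induction arbitrary: f)
  case (introduce i v)
  let ?F = "\<lambda>c. f ((replicate k ({}, 0))[c := ({i}, 1)])"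
  have "bit_at [] = (\<lambda>_. False)" "Collect (bit_at (single_bit i)) = {i}" by auto
  then have "weight f (intro_table (single_bit i, 1) k) = (\<Sum>c<k. ?F c)"
    by (simp add: intro_table_eq weight_def comp_def abstract_state_def map_update sum_list_sum_nth
        atLeast0LessThan)
  also have "\<dots> = (\<Sum>\<phi>\<in>{v} \<rightarrow>\<^sub>E {1..k}. f (profile k {v} (\<lambda>_. i) \<phi>))"
  \<comment> \<open>Positions count from 0 and colors from 1: position \<open>c\<close> stands for
    color \<open>Suc c\<close>.\<close>
  proof (rule sum.reindex_bij_witness[where i = "\<lambda>\<phi>. \<phi> v - 1" and j = "\<lambda>c. (\<lambda>u\<in>{v}. Suc c)"])
    fix \<phi> assume \<phi>: "\<phi> \<in> {v} \<rightarrow>\<^sub>E {1..k}"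
    then have "\<phi> v \<in> {1..k}" by auto
    then show "\<phi> v - 1 \<in> {..<k}" by auto
    show "(\<lambda>u\<in>{v}. Suc (\<phi> v - 1)) = \<phi>"
      using \<phi> by (fastforce simp: fun_eq_iff PiE_def extensional_def)
  next
    fix c assume c: "c \<in> {..<k}"
    have "profile k {v} (\<lambda>_. i) (\<lambda>u\<in>{v}. Suc c) = (replicate k ({}, 0))[c := ({i}, 1)]"
    proof (rule nth_equalityI)
      fix d assume "d < length (profile k {v} (\<lambda>_. i) (\<lambda>u\<in>{v}. Suc c))"
      then have "d < k" by (simp add: profile_def del: upt_Suc)
      moreover have "{u. u = v \<and> restrict (\<lambda>u. Suc c) {v} u = Suc d} = (if c = d then {v} else {})"
        by auto
      ultimately show "profile k {v} (\<lambda>_. i) (\<lambda>u\<in>{v}. Suc c) ! d = (replicate k ({}, 0))[c := ({i}, 1)] ! d"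
        by (simp add: profile_def nth_list_update del: upt_Suc)
    qed (simp add: profile_def del: upt_Suc)
    then show "f (profile k {v} (\<lambda>_. i) (\<lambda>u\<in>{v}. Suc c)) = ?F c" by simp
  qed auto
  also have "{v} \<rightarrow>\<^sub>E {1..k} = colorings k {v} {}" by (simp add: colorings_def)
  finally show ?case by simp
next
  case (disjoint_union s V E lab t V' E' lab')
  note s = builds_props[OF disjoint_union.hyps(1)] and t = builds_props[OF disjoint_union.hyps(2)]
  \<comment> \<open>The inner and the outer \<open>weight\<close> are evaluated by one induction
    hypothesis each.\<close>
  show ?case
    by (simp add: weight_product disjoint_union.IH
        profile_disjoint_union[OF s(1) t(1) disjoint_union.hyps(3)]
        sum_colorings_disjoint_union[OF disjoint_union.hyps(3) s(4) t(4),
          where F = "\<lambda>\<phi> \<psi>. f (combine (profile k V lab \<phi>) (profile k V' lab' \<psi>))"])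
next
  case (relabel t V E lab i j)
  then show ?case by (simp add: weight_relabel profile_relabel)
next
  case (join t V E lab i j)
  have "finite (colorings k V E)"
    using builds_props(1)[OF join.hyps(1)] by (rule finite_colorings)
  then show ?case
    unfolding colorings_join
    by (simp add: weight_join join.IH sum.inter_filter if_not_P)
      (rule sum.cong, auto)
qed

text \<open>The integrand is the indicator of balance, which turns the sum over colorings into a
  count.\<close>

lemma total_balanced_solve:
  assumes "builds w t V E lab"
  shows "total_balanced (solve k t) = num_equitable_colorings k V E"
proof -
  let ?f = "\<lambda>p :: (nat set \<times> nat) list. if \<forall>x\<in>set p. \<forall>y\<in>set p. snd x \<le> snd y + 1 then 1 else 0 :: nat"
  have "total_balanced T = weight ?f T" for T
  proof -
    have "?f (abstract_state s) = (if balanced s then 1 else 0)" for s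
      by (auto simp: abstract_state_def balanced_def)
    then show ?thesis
      unfolding total_balanced_def weight_def
      by (intro arg_cong[where f = sum_list] map_cong) (auto split: prod.split simp del: split_paired_All)
  qed
  moreover have "?f (profile k V lab \<phi>) = (if equitable k V \<phi> then 1 else 0)" for \<phi>
  proof -
    let ?c = "\<lambda>i. card {v \<in> V. \<phi> v = i}"
    have "(\<forall>x\<in>set (profile k V lab \<phi>). \<forall>y\<in>set (profile k V lab \<phi>). snd x \<le> snd y + 1) \<longleftrightarrow>
       (\<forall>i\<in>{1..k}. \<forall>j\<in>{1..k}. ?c i \<le> ?c j + 1)"
      unfolding profile_def set_map set_upt ball_simps atLeastLessThanSuc_atLeastAtMost by simp
    \<comment> \<open>The second inequality is the first with the two colors exchanged.\<close>
    moreover have "\<bar>int a - int b\<bar> \<le> 1 \<longleftrightarrow> a \<le> b + 1 \<and> b \<le> a + 1" for a b by linarith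
    ultimately have "(\<forall>x\<in>set (profile k V lab \<phi>). \<forall>y\<in>set (profile k V lab \<phi>). snd x \<le> snd y + 1) \<longleftrightarrow>
       equitable k V \<phi>"
      unfolding equitable_def by blast
    then show ?thesis by simp
  qed
  ultimately have "total_balanced (solve k t) = (\<Sum>\<phi>\<in>colorings k V E. if equitable k V \<phi> then 1 else 0)"
    by (simp add: weight_solve[OF assms])
  also have "\<dots> = num_equitable_colorings k V E"
    using finite_colorings[OF builds_props(1)[OF assms]]
    by (simp add: num_equitable_colorings_def sum.If_cases Int_def)
  finally show ?thesis .
qed

section \<open>The uniform program, the program with fixed \<open>k\<close>, and their time
  bounds\<close>

section \<open>Running time\<close>

lemma start_correct:
  assumes "builds w t V E lab" "1 \<le> k"
  shows "computes (prog m) START [enc_nat k, enc_instance V E t]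
    (enc_nat (num_equitable_colorings k V E))
    (num_ops t * (20000 * table_bound k w (card V) ^ 5))"
  using start_computes[OF builds_props(3)[OF assms(1)] assms(2), of "card V"]
  by (simp add: builds_props(2)[OF assms(1)] total_balanced_solve[OF assms(1)] enc_instance_def)

text \<open>The two extra steps are the outer call and the reading of its argument.\<close>

lemma outputs_within_prog:
  assumes "computes (prog m) 0 [x] y T"
  shows "outputs_within (prog m) x y (T + 2)"
proof -
  have "wp (prog m) [x] (Call 0 [Arg 0]) (\<lambda>z t. z = y \<and> t \<le> T + 2)"
    by (simp add: wp_computes[OF assms])
  then show ?thesis by (auto simp: wp_def outputs_within_def)
qed

lemma outputs_within_mono: "outputs_within P x y S \<Longrightarrow> S \<le> T \<Longrightarrow> outputs_within P x y T"
  unfolding outputs_within_def using order_trans by blast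

text \<open>\<open>Nul\<close> is the only literal, so a constant is compiled into constructors;
  this builds a fixed \<open>k\<close> into the program.\<close>

fun quote :: "val \<Rightarrow> tm" where
  "quote Nul = MkNul"
| "quote (Cell a b) = MkCell (quote a) (quote b)"

text \<open>A tree with \<open>size v\<close> cells has \<open>size v + 1\<close> leaves, and each
  node costs one step.\<close>

lemma wp_quote [simp]: "wp P \<rho> (quote v) Q \<longleftrightarrow> Q v (2 * size v + 1)"
  by (induction v arbitrary: Q) (simp_all add: algebra_simps)

lemma uniform_program:
  assumes "builds w t V E lab" "1 \<le> k"
  shows "outputs_within (prog (Call START [Left (Arg 0), Right (Arg 0)]))
    (Cell (enc_nat k) (enc_instance V E t)) (enc_nat (num_equitable_colorings k V E))
    (num_ops t * (20000 * table_bound k w (card V) ^ 5) + 10)"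
proof -
  have "computes (prog (Call START [Left (Arg 0), Right (Arg 0)])) 0
      [Cell (enc_nat k) (enc_instance V E t)] (enc_nat (num_equitable_colorings k V E))
      (num_ops t * (20000 * table_bound k w (card V) ^ 5) + 8)"
    by (simp add: computes_def[of _ 0] wp_computes[OF start_correct[OF assms, unfolded One_nat_def]])
  from outputs_within_prog[OF this] show ?thesis by (simp add: ac_simps)
qed

lemma fixed_program:
  assumes "builds w t V E lab" "1 \<le> k"
  shows "outputs_within (prog (Call START [quote (enc_nat k), Arg 0]))
    (enc_instance V E t) (enc_nat (num_equitable_colorings k V E))
    (num_ops t * (20000 * table_bound k w (card V) ^ 5) + 2 * size (enc_nat k) + 10)"
proof -
  have "computes (prog (Call START [quote (enc_nat k), Arg 0])) 0
      [enc_instance V E t] (enc_nat (num_equitable_colorings k V E))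
      (num_ops t * (20000 * table_bound k w (card V) ^ 5) + 2 * size (enc_nat k) + 8)"
    by (simp add: computes_def[of _ 0] wp_computes[OF start_correct[OF assms, unfolded One_nat_def]])
  from outputs_within_prog[OF this] show ?thesis by (simp add: ac_simps)
qed

lemma leaves_pos: "0 < leaves t"
  by (induction t) auto

text \<open>Together with \<open>num_ops_le_size\<close>, the input size bounds the vertices as well
  as the operations.\<close>

lemma leaves_le_num_ops: "leaves t \<le> num_ops t"
  by (induction t) auto

lemma num_ops_le_size: "num_ops t \<le> size (enc_cw_expr t)"
  by (induction t) auto

text \<open>\<open>35 = 15 + 20\<close>: \<open>2 ^ 15\<close> absorbs the constants, and
  \<open>20 = 5 * 4\<close> comes from the fifth power of the state bound. The \<open>2 * a\<close>
  pays for the factors \<open>a\<close> and \<open>w ^ a\<close>. To let one constant serve both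
  exponents, the \<open>a + 5\<close> for \<open>n\<close> is rounded up.\<close>

lemma uniform_time_bound:
  assumes "1 \<le> k" "1 \<le> w" "1 \<le> n" "N \<le> a * (n * w) ^ a" "1 \<le> N"
  shows "N * (20000 * table_bound k w n ^ 5) + 10
    \<le> 2 ^ ((2 * a + 35) * (k * w)) * n ^ ((2 * a + 35) * k)"
proof -
  have kw: "1 \<le> k * w" "w \<le> k * w" "k \<le> k * w" using assms by auto
  have D: "1 \<le> table_bound k w n ^ 5" using table_bound_ge(1)[OF assms(1)] by simp
  \<comment> \<open>For positive \<open>n\<close>, \<open>n + 1 \<le> 2 * n\<close> leaves a pure
    power of \<open>n\<close>.\<close>
  have "table_bound k w n \<le> (2 ^ (w + 2) * (2 * n)) ^ k"
    unfolding table_bound_def using assms(3) by (intro power_mono mult_left_mono) auto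
  also have "\<dots> = 2 ^ ((w + 3) * k) * n ^ k"
  proof -
    have "(2 :: nat) ^ (w + 2) * (2 * n) = 2 ^ (w + 3) * n"
      by (simp add: power_add)
    then show ?thesis by (simp only: power_mult_distrib power_mult)
  qed
  also have "\<dots> \<le> 2 ^ (4 * (k * w)) * n ^ k"
    using kw by (intro mult_right_mono power_increasing) (auto simp: algebra_simps)
  finally have "table_bound k w n ^ 5 \<le> (2 ^ (4 * (k * w)) * n ^ k) ^ 5" by (rule power_mono) simp
  then have bound: "table_bound k w n ^ 5 \<le> 2 ^ (20 * (k * w)) * n ^ (5 * k)"
    by (simp add: power_mult_distrib flip: power_mult) (simp add: mult.commute mult.left_commute)
  have ops: "N \<le> 2 ^ (2 * a * (k * w)) * n ^ (a * k)"
  proof -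
    have "a \<le> 2 ^ a" by (simp add: less_imp_le)
    also have "\<dots> \<le> 2 ^ (a * (k * w))" using kw by (intro power_increasing) auto
    finally have "a \<le> 2 ^ (a * (k * w))" .
    moreover have "w ^ a \<le> 2 ^ (a * (k * w))"
    proof -
      have "w ^ a \<le> (2 ^ w) ^ a" by (intro power_mono) (simp_all add: less_imp_le)
      also have "\<dots> = 2 ^ (a * w)" by (simp add: mult.commute flip: power_mult)
      also have "\<dots> \<le> 2 ^ (a * (k * w))" using kw by (intro power_increasing mult_left_mono) auto
      finally show ?thesis .
    qed
    moreover have "n ^ a \<le> n ^ (a * k)" using assms by (intro power_increasing) auto
    ultimately have "a * (n ^ a * w ^ a) \<le> 2 ^ (a * (k * w)) * (n ^ (a * k) * 2 ^ (a * (k * w)))"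
      by (intro mult_mono) auto
    also have "\<dots> = 2 ^ (2 * a * (k * w)) * n ^ (a * k)"
      by (simp add: mult_2 add_mult_distrib power_add)
    finally show ?thesis using assms(4) by (simp add: power_mult_distrib)
  qed
  have "1 \<le> N * table_bound k w n ^ 5" using D assms(5) by simp
  then have "N * (20000 * table_bound k w n ^ 5) + 10 \<le> 2 ^ 15 * (N * table_bound k w n ^ 5)"
    by (simp del: One_nat_def)
  also have "\<dots> \<le> 2 ^ (15 * (k * w)) *
      ((2 ^ (2 * a * (k * w)) * n ^ (a * k)) * (2 ^ (20 * (k * w)) * n ^ (5 * k)))"
    using kw(1) ops bound by (intro mult_mono power_increasing) auto
  also have "\<dots> = 2 ^ ((2 * a + 35) * (k * w)) * n ^ ((a + 5) * k)"
    by (simp add: algebra_simps flip: power_add)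
  also have "\<dots> \<le> 2 ^ ((2 * a + 35) * (k * w)) * n ^ ((2 * a + 35) * k)"
    using assms(3) by (intro mult_left_mono power_increasing mult_right_mono) auto
  finally show ?thesis .
qed

theorem theorem1p1:
  "(\<exists>P. \<forall>a. \<exists>C. \<forall>k w n V E t.
      1 \<le> k \<longrightarrow> 1 \<le> w \<longrightarrow> simple_graph V E \<longrightarrow> card V = n \<longrightarrow>
      w_expression_of w t V E \<longrightarrow> num_ops t \<le> a * (n * w) ^ a \<longrightarrow>
      outputs_within P (Cell (enc_nat k) (enc_instance V E t))
        (enc_nat (num_equitable_colorings k V E))
        (2 ^ (C * (k * w)) * n ^ (C * k)))
   \<and>
   (\<forall>k \<G>. 1 \<le> k \<longrightarrow> (\<forall>(V, E)\<in>\<G>. simple_graph V E) \<longrightarrow> bounded_clique_width \<G> \<longrightarrow>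
      (\<exists>Q. \<forall>c. \<exists>p :: nat poly. \<forall>(V, E)\<in>\<G>. \<forall>t.
         w_expression_of c t V E \<longrightarrow>
         outputs_within Q (enc_instance V E t)
           (enc_nat (num_equitable_colorings k V E))
           (poly p (size (enc_instance V E t)))))"
proof (intro conjI)
  show "\<exists>P. \<forall>a. \<exists>C. \<forall>k w n V E t.
      1 \<le> k \<longrightarrow> 1 \<le> w \<longrightarrow> simple_graph V E \<longrightarrow> card V = n \<longrightarrow>
      w_expression_of w t V E \<longrightarrow> num_ops t \<le> a * (n * w) ^ a \<longrightarrow>
      outputs_within P (Cell (enc_nat k) (enc_instance V E t))
        (enc_nat (num_equitable_colorings k V E))
        (2 ^ (C * (k * w)) * n ^ (C * k))"
  \<comment> \<open>The program is fixed before \<open>a\<close>; only the constant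
    \<open>2 * a + 35\<close> depends on it.\<close>
  proof (intro exI[of _ "prog (Call START [Left (Arg 0), Right (Arg 0)])"] allI
      exI[of _ "2 * _ + 35"] impI)
    fix a k w n :: nat and V :: "nat set" and E t
    assume k: "1 \<le> k" and w: "1 \<le> w" and n: "card V = n"
      and "w_expression_of w t V E" and ops: "num_ops t \<le> a * (n * w) ^ a"
    then obtain lab where b: "builds w t V E lab" by (auto simp: w_expression_of_def)
    \<comment> \<open>An expression introduces at least one vertex, so powers of \<open>n\<close>
      are positive and can bound the time.\<close>
    have "1 \<le> n" using builds_props(2)[OF b] n leaves_pos[of t] by simp
    then show "outputs_within (prog (Call START [Left (Arg 0), Right (Arg 0)]))
        (Cell (enc_nat k) (enc_instance V E t)) (enc_nat (num_equitable_colorings k V E))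
        (2 ^ ((2 * a + 35) * (k * w)) * n ^ ((2 * a + 35) * k))"
      using uniform_program[OF b k] uniform_time_bound[OF k w _ ops]
      unfolding n by (auto intro: outputs_within_mono simp: Suc_le_eq)
  qed
next
  show "\<forall>k \<G>. 1 \<le> k \<longrightarrow> (\<forall>(V, E)\<in>\<G>. simple_graph V E) \<longrightarrow> bounded_clique_width \<G> \<longrightarrow>
      (\<exists>Q. \<forall>c. \<exists>p :: nat poly. \<forall>(V, E)\<in>\<G>. \<forall>t.
         w_expression_of c t V E \<longrightarrow>
         outputs_within Q (enc_instance V E t)
           (enc_nat (num_equitable_colorings k V E))
           (poly p (size (enc_instance V E t))))"
  proof (intro allI impI)
    fix k :: nat and \<G> :: "(nat set \<times> nat set set) set"
    assume k: "1 \<le> k"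
    \<comment> \<open>\<open>k\<close> is compiled into the program, whereas \<open>c\<close> enters
      only through the polynomial.\<close>
    let ?Q = "prog (Call START [quote (enc_nat k), Arg 0])"
    \<comment> \<open>The variable is the input size: it replaces the number of operations and,
      increased by 1, the factor \<open>n + 1\<close> of the state bound.\<close>
    let ?p = "\<lambda>c. [:0, 1:] * [:20000 * 2 ^ ((c + 2) * k * 5):] * [:1, 1:] ^ (k * 5) +
      [:2 * size (enc_nat k) + 10:] :: nat poly"
    have "outputs_within ?Q (enc_instance V E t) (enc_nat (num_equitable_colorings k V E))
        (poly (?p c) (size (enc_instance V E t)))"
      if expr: "w_expression_of c t V E" for c V E t
    proof -
      obtain lab where b: "builds c t V E lab"
        using expr by (auto simp: w_expression_of_def)
      let ?s = "size (enc_instance V E t)"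
      have N: "num_ops t \<le> ?s"
        using num_ops_le_size[of t] by (simp add: enc_instance_def)
      then have n: "card V \<le> ?s"
        using builds_props(2)[OF b] leaves_le_num_ops[of t] by simp
      have "table_bound k c (card V) ^ 5 \<le> (2 ^ (c + 2) * (?s + 1)) ^ (k * 5)"
        unfolding table_bound_def power_mult[symmetric] using n by (intro power_mono mult_left_mono) auto
      also have "\<dots> = 2 ^ ((c + 2) * k * 5) * (?s + 1) ^ (k * 5)"
        by (simp only: power_mult_distrib mult.assoc power_mult[symmetric])
      finally have "num_ops t * (20000 * table_bound k c (card V) ^ 5)
          \<le> ?s * (20000 * (2 ^ ((c + 2) * k * 5) * (?s + 1) ^ (k * 5)))"
        using N by (intro mult_mono) auto
      then have "num_ops t * (20000 * table_bound k c (card V) ^ 5) + 2 * size (enc_nat k) + 10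
          \<le> poly (?p c) ?s"
        by (simp add: mult.assoc)
      then show ?thesis
        by (rule outputs_within_mono[OF fixed_program[OF b k]])
    qed
    then show "\<exists>Q. \<forall>c. \<exists>p :: nat poly. \<forall>(V, E)\<in>\<G>. \<forall>t.
         w_expression_of c t V E \<longrightarrow>
         outputs_within Q (enc_instance V E t)
           (enc_nat (num_equitable_colorings k V E))
           (poly p (size (enc_instance V E t)))"
      by (intro exI[of _ ?Q] allI exI[of _ "?p _"]) blast
  qed
qed

end
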